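(* Let $\mu,\nu,t\in\mathbb{C}$ with $\Re(\mu+\nu)>-1$, and let $r_N,\bar r_N$ ($N\ge0$) be the reflection coefficients of the orthogonal polynomial system on the unit circle with weight $w(z)=(1+z)^{\mu}(1+1/z)^{\nu}e^{tz}$, where it is assumed that the Toeplitz determinants $I^0_N[w]$ are nonzero for all $N\ge1$. Then for all $N\ge1$ $$(N-1+\nu)r_{N-1}+(N+\mu+t)r_N=-t(1-r_N\bar r_N)r_{N+1}+t\,r_N^2\,\bar r_{N-1},$$ $$(N+1+\nu)\bar r_{N+1}+(N+\mu+t)\bar r_N=-t(1-r_N\bar r_N)\bar r_{N-1}+t\,\bar r_N^2\,r_{N+1},$$ subject to the initial conditions $r_0=\bar r_0=1$ and $$r_1=-\frac{\nu}{\mu+1}\,\frac{{}_1F_1(-\nu+1;\mu+2;-t)}{{}_1F_1(-\nu;\mu+1;-t)},\qquad \bar r_1=-\frac{\mu}{\nu+1}\,\frac{{}_1F_1(-\nu-1;\mu;-t)}{{}_1F_1(-\nu;\mu+1;-t)}$$ (when $\mu$ is a non-positive integer the last two expressions are understood by continuity in $\mu$).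
   Context: On the unit circle, $w(e^{i\theta})=e^{i\theta(\mu-\nu)/2}\,|1+e^{i\theta}|^{\mu+\nu}\,e^{te^{i\theta}}$ for $-\pi<\theta\le\pi$ (principal branches). Its Fourier coefficients are $w_k=\frac1{2\pi}\int_{-\pi}^{\pi}w(e^{i\theta})e^{-ik\theta}\,d\theta$, $k\in\mathbb{Z}$. For $\epsilon\in\{0,1,-1\}$ put $I^\epsilon_N[w]=\det[w_{-\epsilon+j-k}]_{0\le j,k\le N-1}$, $I^\epsilon_0[w]=1$. The reflection coefficients are $r_N=(-1)^N I^1_N[w]/I^0_N[w]$ and $\bar r_N=(-1)^N I^{-1}_N[w]/I^0_N[w]$; these are in general two independent quantities and the bar does not mean complex conjugation. *)

theory Defs
  imports
    "HOL-Analysis.Analysis"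
    "Jordan_Normal_Form.Determinant"
begin

(* Weights on the unit circle are functions of the angle \<theta> in (-pi, pi].
   At \<theta> = pi the value is 0 because 0 powr x = 0; this is irrelevant for the integrals. *)

definition circle_weight :: "complex \<Rightarrow> complex \<Rightarrow> complex \<Rightarrow> real \<Rightarrow> complex" where
  "circle_weight \<mu> \<nu> t \<theta> =
     exp (\<i> * of_real \<theta> * (\<mu> - \<nu>) / 2) *
     of_real (cmod (1 + cis \<theta>)) powr (\<mu> + \<nu>) *
     exp (t * cis \<theta>)"

lemma circle_weight_eq_powr:
  fixes z :: complex
  assumes "-pi < \<theta>" "\<theta> \<le> pi" and z: "z = cis \<theta>"
  shows "circle_weight \<mu> \<nu> t \<theta> = (1 + z) powr \<mu> * (1 + 1 / z) powr \<nu> * exp (t * z)"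
proof (cases "\<theta> = pi")
  case True
  then show ?thesis by (simp add: circle_weight_def z)
next
  case False
  with assms have c: "cos (\<theta> / 2) > 0"
    by (intro cos_gt_zero_pi) auto
  define c where "c = 2 * cos (\<theta> / 2)"
  have c0: "c > 0" using c by (simp add: c_def)
  have dbl: "1 + cis s = of_real (2 * cos (s / 2)) * cis (s / 2)" for s
  proof -
    have "1 + cis s = cis (s / 2) * (cis (- s / 2) + cis (s / 2))"
      by (simp add: distrib_left cis_mult)
    also have "cis (- s / 2) + cis (s / 2) = of_real (2 * cos (s / 2))"
      by (simp add: complex_eq_iff)
    finally show ?thesis by (simp add: mult.commute)
  qed
  have p: "1 + z = of_real c * exp (\<i> * of_real (\<theta> / 2))"
    using dbl[of \<theta>] by (simp add: z c_def cis_conv_exp)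
  have m: "1 + 1 / z = of_real c * exp (\<i> * of_real (- \<theta> / 2))"
    using dbl[of "-\<theta>"] by (simp add: z c_def cis_conv_exp exp_minus field_simps)
  have ln_polar: "Ln (of_real c * exp (\<i> * of_real s)) = of_real (ln c) + \<i> * of_real s"
    if "\<bar>s\<bar> < pi" for s
  proof -
    have "of_real c * exp (\<i> * of_real s) = exp (of_real (ln c) + \<i> * of_real s)"
      using c0 by (simp add: exp_add exp_of_real)
    then show ?thesis using that by (simp add: Ln_exp)
  qed
  have norm: "cmod (1 + cis \<theta>) = c"
    using p c0 by (simp add: z norm_mult)
  have "(1 + z) powr \<mu> * (1 + 1 / z) powr \<nu> =
      exp (\<mu> * (of_real (ln c) + \<i> * of_real (\<theta> / 2))) *
      exp (\<nu> * (of_real (ln c) + \<i> * of_real (- \<theta> / 2)))"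
    unfolding p m using c0 assms
    by (subst (1 2) powr_def) (simp add: ln_polar del: of_real_divide of_real_minus)
  also have "\<dots> = exp (\<i> * of_real \<theta> * (\<mu> - \<nu>) / 2) * exp ((\<mu> + \<nu>) * of_real (ln c))"
    unfolding exp_add[symmetric]
    by (rule arg_cong[where f = exp]) (simp add: field_simps)
  also have "exp ((\<mu> + \<nu>) * of_real (ln c)) = of_real c powr (\<mu> + \<nu>)"
    using c0 by (simp add: powr_def Ln_of_real)
  finally show ?thesis by (simp add: circle_weight_def norm z)
qed

definition fourier_coeff :: "(real \<Rightarrow> complex) \<Rightarrow> int \<Rightarrow> complex" where
  "fourier_coeff w k =
     1 / (2 * of_real pi) *
     integral {-pi..pi} (\<lambda>\<theta>. w \<theta> * exp (- \<i> * of_int k * of_real \<theta>))"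

definition toeplitz_det :: "int \<Rightarrow> nat \<Rightarrow> (real \<Rightarrow> complex) \<Rightarrow> complex" where
  "toeplitz_det \<epsilon> N w =
     Determinant.det (Matrix.mat N N (\<lambda>(j, k). fourier_coeff w (- \<epsilon> + int j - int k)))"

lemma toeplitz_det_0: "toeplitz_det \<epsilon> 0 w = 1"
  by (simp add: toeplitz_det_def)

definition refl_coeff :: "(real \<Rightarrow> complex) \<Rightarrow> nat \<Rightarrow> complex" where
  "refl_coeff w N = (-1) ^ N * toeplitz_det 1 N w / toeplitz_det 0 N w"

(* Not the complex conjugate of refl_coeff in general. *)
definition refl_coeff_bar :: "(real \<Rightarrow> complex) \<Rightarrow> nat \<Rightarrow> complex" where
  "refl_coeff_bar w N = (-1) ^ N * toeplitz_det (-1) N w / toeplitz_det 0 N w"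

(* Only meaningful for b not a non-positive integer: division by zero would otherwise
   silently drop the terms of the series with a vanishing denominator. *)
definition hyp_1F1 :: "complex \<Rightarrow> complex \<Rightarrow> complex \<Rightarrow> complex" where
  "hyp_1F1 a b z = eval_fps (fps_hypergeo [a] [b] 1) z"

lemma hyp_1F1_eq_suminf:
  "hyp_1F1 a b z = (\<Sum>n. pochhammer a n / pochhammer b n * z ^ n / fact n)"
  by (simp add: hyp_1F1_def eval_fps_def field_simps)

end

(*
  Integrating d/dtheta ((1 + z) w z^(-k)) over the circle gives the three-term recurrence
    (k + nu) w_k = (mu - k + 1 + t) w_(k-1) + t w_(k-2)
  for the Fourier coefficients. By linearity it becomes an identity for z^(-m) p(z) with an arbitrary
  polynomial p. Let Phi_n be the monic orthogonal polynomials and Phi*_n the reversed polynomials of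
  their biorthogonal partners, so that Phi_n(0) = r_n and the coefficient of z^n in Phi*_n is rb_n.
  The identity for p = Phi_n Phi*_n expresses the coefficient of z in Phi*_n through the reflection
  coefficients; eliminating it from the identities for p = Phi_(n+1) Phi_n and
  p = Phi*_(n+1) Phi*_n yields the two recurrences.
  For the initial values, expand e^(tz): then w_k(t) = sum_n t^n/n! w_(k-n)(0), and for t = 0 the
  recurrence has two terms, so this is a 1F1 series. When mu is a non-positive integer, use that
  w_k depends continuously on mu, by dominated convergence.
*)

theory Submission
  imports Defs "HOL-Computational_Algebra.Polynomial"
begin

section \<open>Moments and Toeplitz determinants\<close>

text \<open>For \<open>c\<close> the Fourier coefficients of a weight w, this is the
  \<open>m\<close>-th Fourier coefficient of p w, the mean of z^(-m) p(z) w(z) over the circle.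
  Keeping \<open>c\<close> arbitrary makes the orthogonality arguments purely algebraic.\<close>

definition moment :: "(int \<Rightarrow> 'a::field) \<Rightarrow> int \<Rightarrow> 'a poly \<Rightarrow> 'a" where
  "moment c m p = (\<Sum>i\<le>degree p. poly.coeff p i * c (m - int i))"

lemma moment_altdef:
  assumes "degree p \<le> n"
  shows "moment c m p = (\<Sum>i\<le>n. poly.coeff p i * c (m - int i))"
  unfolding moment_def
  by (rule sum.mono_neutral_left) (use assms in \<open>auto simp: coeff_eq_0\<close>)

lemma moment_add: "moment c m (p + q) = moment c m p + moment c m q"
proof -
  let ?n = "max (degree p) (degree q)"
  show ?thesis
    using moment_altdef[of "p + q" ?n c m] moment_altdef[of p ?n c m] moment_altdef[of q ?n c m]
    by (simp add: degree_add_le sum.distrib algebra_simps)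
qed

lemma moment_smult: "moment c m (Polynomial.smult a p) = a * moment c m p"
  using moment_altdef[of "Polynomial.smult a p" "degree p" c m]
  by (simp add: degree_smult_le moment_def sum_distrib_left mult.assoc)

lemma moment_minus: "moment c m (- p) = - moment c m p"
  using moment_smult[of c m "-1" p] by simp

lemma moment_diff: "moment c m (p - q) = moment c m p - moment c m q"
  using moment_add[of c m p "- q"] by (simp add: moment_minus)

lemma moment_0 [simp]: "moment c m 0 = 0"
  by (simp add: moment_def)

lemma moment_pCons: "moment c m (pCons a p) = a * c m + moment c (m - 1) p"
proof -
  have "moment c m (pCons a p) = (\<Sum>i\<le>Suc (degree p). poly.coeff (pCons a p) i * c (m - int i))"
    by (rule moment_altdef) (rule degree_pCons_le)
  also have "\<dots> = a * c m + moment c (m - 1) p"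
    unfolding moment_def
    by (subst sum.atMost_Suc_shift) (simp add: coeff_pCons algebra_simps)
  finally show ?thesis .
qed

lemmas moment_simps = moment_add moment_diff moment_minus moment_smult moment_pCons

lemma moment_mult:
  assumes "degree q \<le> n"
  shows "moment c m (p * q) = (\<Sum>k\<le>n. poly.coeff q k * moment c (m - int k) p)"
  using assms
proof (induction n arbitrary: q m)
  case 0
  then obtain a where "q = [:a:]" using degree_eq_zeroE by blast
  then show ?case by (simp add: moment_simps)
next
  case (Suc n)
  obtain a q' where q: "q = pCons a q'" by (cases q)
  have "degree q' \<le> n" using Suc.prems by (cases "q' = 0") (auto simp: q)
  from Suc.IH[OF this] show ?case
    by (subst sum.atMost_Suc_shift) (simp add: q moment_simps algebra_simps)
qed

text \<open>Meant for a \<open>p\<close> that is orthogonal to all but one power in the window from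
  \<open>m - n\<close> to \<open>m\<close>. An index \<open>j > n\<close> is allowed: both sides are
  then 0.\<close>

lemma moment_mult_single:
  assumes "degree q \<le> n"
    and "\<And>k. k \<le> n \<Longrightarrow> k \<noteq> j \<Longrightarrow> moment c (m - int k) p = 0"
  shows "moment c m (p * q) = poly.coeff q j * moment c (m - int j) p"
proof -
  have "moment c m (p * q) = (\<Sum>k\<le>n. poly.coeff q k * moment c (m - int k) p)"
    by (rule moment_mult) fact
  also have "\<dots> = (\<Sum>k\<in>{..n} \<inter> {j}. poly.coeff q k * moment c (m - int k) p)"
    by (rule sum.mono_neutral_right) (use assms(2) in auto)
  also have "\<dots> = poly.coeff q j * moment c (m - int j) p"
    using assms(1) by (cases "j \<le> n") (auto simp: coeff_eq_0)
  finally show ?thesis .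
qed

definition toeplitz :: "(int \<Rightarrow> 'a::comm_ring_1) \<Rightarrow> int \<Rightarrow> nat \<Rightarrow> 'a" where
  "toeplitz c \<epsilon> N = Determinant.det (Matrix.mat N N (\<lambda>(j, k). c (- \<epsilon> + int j - int k)))"

text \<open>Reversing the sequence transposes the matrix. This carries \<open>toeplitz_shift\<close>
  over from \<open>r\<close> to \<open>rb\<close>.\<close>

lemma toeplitz_reflect: "toeplitz (\<lambda>k. c (- k)) \<epsilon> N = toeplitz c (- \<epsilon>) N"
proof -
  have "Matrix.mat N N (\<lambda>(j, k). c (- (- \<epsilon> + int j - int k))) =
      transpose_mat (Matrix.mat N N (\<lambda>(j, k). c (- (- \<epsilon>) + int j - int k)))"
    by (rule eq_matI) (auto simp: algebra_simps)
  then show ?thesis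
    unfolding toeplitz_def by (simp add: Determinant.det_transpose[where n = N])
qed

text \<open>Replacing the last column by the combination of all columns with weights
  \<open>a\<close> keeps the determinant, as \<open>a N = 1\<close>, and orthogonality clears that
  column except for its bottom entry. The free last row \<open>v\<close> serves both determinant
  formulas below.\<close>

lemma det_toeplitz_last_row:
  fixes c :: "int \<Rightarrow> 'a::field"
  assumes "a N = 1" and orth: "\<And>j. j < N \<Longrightarrow> (\<Sum>k\<le>N. a k * c (int j - int k)) = 0"
  shows "Determinant.det (Matrix.mat (Suc N) (Suc N)
      (\<lambda>(j, k). if j < N then c (int j - int k) else v k)) = (\<Sum>k\<le>N. a k * v k) * toeplitz c 0 N"
proof -
  define Q where "Q = Matrix.mat (Suc N) (Suc N) (\<lambda>(j, k). if j < N then c (int j - int k) else v k)"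
  define U where "U = Matrix.mat (Suc N) (Suc N) (\<lambda>(i, k). if k = N then a i else of_bool (i = k))"
  have [simp]: "Q \<in> carrier_mat (Suc N) (Suc N)" "U \<in> carrier_mat (Suc N) (Suc N)"
    by (simp_all add: Q_def U_def)
  have "Determinant.det U = prod_list (diag_mat U)"
    by (rule det_upper_triangular[where n = "Suc N"]) (auto simp: U_def)
  also have "diag_mat U = map (\<lambda>i. 1) [0..<Suc N]"
    unfolding diag_mat_def using assms(1) by (intro map_cong) (auto simp: U_def)
  also have "prod_list \<dots> = 1"
    by (simp add: map_replicate_const)
  finally have U1: "Determinant.det U = 1" .
  have QU: "Q * U = Matrix.mat (Suc N) (Suc N)
      (\<lambda>(j, k). if k = N then of_bool (j = N) * (\<Sum>k\<le>N. a k * v k) else Q $$ (j, k))"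
    (is "_ = ?M")
  proof (rule eq_matI)
    fix j k assume "j < dim_row ?M" "k < dim_col ?M"
    then have jk: "j < Suc N" "k < Suc N" by auto
    have "(Q * U) $$ (j, k) = (\<Sum>i = 0..<Suc N. Q $$ (j, i) * U $$ (i, k))"
      using jk by (simp add: scalar_prod_def Q_def U_def)
    also have "\<dots> = ?M $$ (j, k)"
    proof (cases "k = N")
      case True
      have "(\<Sum>i = 0..<Suc N. Q $$ (j, i) * U $$ (i, k)) =
          (\<Sum>i\<le>N. a i * (if j < N then c (int j - int i) else v i))"
        using jk True by (intro sum.cong) (auto simp: Q_def U_def)
      also have "\<dots> = (if j < N then 0 else (\<Sum>i\<le>N. a i * v i))"
        using orth[of j] by simp
      finally show ?thesis using jk True by auto
    next
      case False
      have "(\<Sum>i = 0..<Suc N. Q $$ (j, i) * U $$ (i, k)) = (\<Sum>i = 0..<Suc N. if i = k then Q $$ (j, k) else 0)"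
        using jk False by (intro sum.cong) (auto simp: U_def)
      then show ?thesis using jk False by simp
    qed
    finally show "(Q * U) $$ (j, k) = ?M $$ (j, k)" .
  qed (auto simp: Q_def U_def)
  have "Determinant.det Q = Determinant.det (Q * U)"
    using U1 by (simp add: Determinant.det_mult[where n = "Suc N"])
  also have "\<dots> = (\<Sum>i<Suc N. (Q * U) $$ (i, N) * cofactor (Q * U) i N)"
    by (rule laplace_expansion_column[where n = "Suc N"]) (auto simp: Q_def U_def)
  also have "\<dots> = (\<Sum>i<Suc N. if i = N then (\<Sum>k\<le>N. a k * v k) * cofactor (Q * U) N N else 0)"
    by (rule sum.cong) (auto simp: QU)
  also have "\<dots> = (\<Sum>k\<le>N. a k * v k) * cofactor (Q * U) N N"
    by simp
  also have "cofactor (Q * U) N N = toeplitz c 0 N"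
  proof -
    have "mat_delete (Q * U) N N = Matrix.mat N N (\<lambda>(j, k). c (int j - int k))"
      unfolding QU by (rule eq_matI) (auto simp: mat_delete_def Q_def)
    then show ?thesis by (simp add: cofactor_def toeplitz_def)
  qed
  finally show ?thesis by (simp add: Q_def)
qed

text \<open>With \<open>a\<close> the coefficients of the monic orthogonal polynomial, the quotient
  of consecutive determinants is its norm. So nonvanishing determinants give nonzero norms.\<close>

lemma toeplitz_Suc:
  fixes c :: "int \<Rightarrow> 'a::field"
  assumes "a N = 1" and "\<And>j. j < N \<Longrightarrow> (\<Sum>k\<le>N. a k * c (int j - int k)) = 0"
  shows "toeplitz c 0 (Suc N) = (\<Sum>k\<le>N. a k * c (int N - int k)) * toeplitz c 0 N"
proof -
  have "Matrix.mat (Suc N) (Suc N) (\<lambda>(j, k). c (int j - int k)) =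
      Matrix.mat (Suc N) (Suc N) (\<lambda>(j, k). if j < N then c (int j - int k) else c (int N - int k))"
    by (rule eq_matI) (auto simp: less_Suc_eq)
  then show ?thesis
    using det_toeplitz_last_row[of a N c "\<lambda>k. c (int N - int k)"] assms
    by (simp add: toeplitz_def)
qed

lemma toeplitz_shift:
  fixes c :: "int \<Rightarrow> 'a::field"
  assumes "a N = 1" and "\<And>j. j < N \<Longrightarrow> (\<Sum>k\<le>N. a k * c (int j - int k)) = 0"
  shows "(- 1) ^ N * toeplitz c 1 N = a 0 * toeplitz c 0 N"
proof -
  \<comment> \<open>The unit last row selects the minor without column 0. Deleting that column
    shifts the others by one, which is the case \<epsilon> = 1, and the cofactor sign is
    \<open>(- 1) ^ N\<close>.\<close>
  define Q where "Q = Matrix.mat (Suc N) (Suc N)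
    (\<lambda>(j, k). if j < N then c (int j - int k) else of_bool (k = 0))"
  have "Determinant.det Q = (\<Sum>k<Suc N. Q $$ (N, k) * cofactor Q N k)"
    by (rule laplace_expansion_row[where n = "Suc N"]) (auto simp: Q_def)
  also have "\<dots> = (\<Sum>k<Suc N. if k = 0 then cofactor Q N 0 else 0)"
    by (rule sum.cong) (auto simp: Q_def)
  also have "\<dots> = cofactor Q N 0" by simp
  also have "mat_delete Q N 0 = Matrix.mat N N (\<lambda>(j, k). c (- 1 + int j - int k))"
    by (rule eq_matI) (auto simp: mat_delete_def Q_def algebra_simps)
  then have "cofactor Q N 0 = (- 1) ^ N * toeplitz c 1 N"
    by (simp add: cofactor_def toeplitz_def)
  finally have "(- 1) ^ N * toeplitz c 1 N = Determinant.det Q" by simp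
  also have "\<dots> = (\<Sum>k\<le>N. a k * of_bool (k = 0)) * toeplitz c 0 N"
    unfolding Q_def by (rule det_toeplitz_last_row) fact+
  also have "(\<Sum>k\<le>N. a k * of_bool (k = 0)) = (\<Sum>k\<le>N. if k = 0 then a 0 else 0)"
    by (rule sum.cong) auto
  finally show ?thesis by simp
qed

section \<open>Biorthogonal polynomials\<close>

locale toeplitz_system =
  fixes c :: "int \<Rightarrow> 'a::field_char_0"
  assumes toeplitz_nonzero: "toeplitz c 0 N \<noteq> 0"
begin

text \<open>The pair consists of the monic orthogonal polynomial \<open>\<Phi>\<^sub>n\<close> and the reversed polynomial
  \<open>\<Phi>\<^sup>*\<^sub>n(z) = z\<^sup>n \<Psi>\<^sub>n(1/z)\<close> of its biorthogonal partner \<open>\<Psi>\<^sub>n\<close>, generated by the Szego recurrence.\<close>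

primrec szego :: "nat \<Rightarrow> 'a poly \<times> 'a poly" where
  "szego 0 = (1, 1)"
| "szego (Suc n) = (let (p, s) = szego n; h = moment c (int n) p in
     (pCons 0 p - Polynomial.smult (moment c (-1) p / h) s,
      s - Polynomial.smult (moment c (int n + 1) s / h) (pCons 0 p)))"

definition "\<Phi> n = fst (szego n)"
definition "S n = snd (szego n)"
text \<open>The pairing of \<Phi>_n with its biorthogonal partner: by orthogonality only the leading
  term of the monic partner contributes.\<close>

definition "h n = moment c (int n) (\<Phi> n)"
definition "r n = poly.coeff (\<Phi> n) 0"
definition "rb n = poly.coeff (S n) n"

lemma szego_0 [simp]: "\<Phi> 0 = 1" "S 0 = 1" "r 0 = 1" "rb 0 = 1"
  by (simp_all add: \<Phi>_def S_def r_def rb_def)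

lemma szego_Suc:
  "\<Phi> (Suc n) = pCons 0 (\<Phi> n) - Polynomial.smult (moment c (-1) (\<Phi> n) / h n) (S n)"
  "S (Suc n) = S n - Polynomial.smult (moment c (int n + 1) (S n) / h n) (pCons 0 (\<Phi> n))"
  by (simp_all add: \<Phi>_def S_def h_def case_prod_unfold Let_def)

lemma coeff_S_0 [simp]: "poly.coeff (S n) 0 = 1"
  by (induction n) (simp_all add: szego_Suc)

lemma degree_szego: "degree (\<Phi> n) \<le> n \<and> degree (S n) \<le> n"
proof (induction n)
  case (Suc n)
  then have "degree (pCons 0 (\<Phi> n)) \<le> Suc n" "degree (S n) \<le> Suc n"
    using degree_pCons_le[of 0 "\<Phi> n"] by linarith+
  then show ?case
    unfolding szego_Suc by (meson degree_diff_le degree_smult_le order_trans)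
qed auto

lemmas degree_\<Phi> = degree_szego[THEN conjunct1] and degree_S = degree_szego[THEN conjunct2]

lemma coeff_\<Phi>_top [simp]: "poly.coeff (\<Phi> n) n = 1"
  by (induction n) (use degree_S in \<open>simp_all add: szego_Suc coeff_eq_0 le_imp_less_Suc\<close>)

text \<open>Multiplication by z kills the constant term and \<open>S n\<close> has constant term 1,
  so up to sign the multiplier in the Szego step is the new reflection coefficient.\<close>

lemma r_Suc: "r (Suc n) = - moment c (-1) (\<Phi> n) / h n"
  by (simp add: r_def szego_Suc)

lemma rb_Suc: "rb (Suc n) = - moment c (int n + 1) (S n) / h n"
  using degree_S[of n] by (simp add: rb_def szego_Suc coeff_eq_0)

lemma \<Phi>_Suc: "\<Phi> (Suc n) = pCons 0 (\<Phi> n) + Polynomial.smult (r (Suc n)) (S n)"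
  and S_Suc: "S (Suc n) = S n + Polynomial.smult (rb (Suc n)) (pCons 0 (\<Phi> n))"
  by (simp_all only: r_Suc rb_Suc szego_Suc) (simp_all add: minus_divide_left[symmetric])

lemma coeff_\<Phi>_Suc_1: "poly.coeff (\<Phi> (Suc n)) 1 = r n + r (Suc n) * poly.coeff (S n) 1"
  unfolding \<Phi>_Suc by (simp add: r_def[of n])

lemma moment_\<Phi>_step:
    "moment c j (\<Phi> (Suc n)) = moment c (j - 1) (\<Phi> n) + r (Suc n) * moment c j (S n)"
  and moment_S_step:
    "moment c j (S (Suc n)) = moment c j (S n) + rb (Suc n) * moment c (j - 1) (\<Phi> n)"
  unfolding \<Phi>_Suc S_Suc by (simp_all add: moment_simps)

text \<open>One joint induction, because each polynomial's orthogonality uses that of the other at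
  the previous degree, and the multipliers divide by \<open>h n\<close>. Each multiplier is chosen
  to kill the one moment that the induction hypothesis does not cover: index 0 for \<Phi>, index n +
  1 for \<open>S\<close>.\<close>

lemma orthogonal_h:
  "h n \<noteq> 0 \<and> (\<forall>j. 0 \<le> j \<and> j < int n \<longrightarrow> moment c j (\<Phi> n) = 0) \<and>
   (\<forall>j. 1 \<le> j \<and> j \<le> int n \<longrightarrow> moment c j (S n) = 0) \<and> moment c 0 (S n) = h n"
proof (induction n)
  case 0
  have "toeplitz c 0 (Suc 0) = c 0"
    by (simp add: toeplitz_def det_single)
  then show ?case using toeplitz_nonzero[of "Suc 0"] by (auto simp: h_def moment_def)
next
  case (Suc n)
  then have h: "h n \<noteq> 0" and \<Phi>: "\<And>j. 0 \<le> j \<Longrightarrow> j < int n \<Longrightarrow> moment c j (\<Phi> n) = 0"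
    and S: "\<And>j. 1 \<le> j \<Longrightarrow> j \<le> int n \<Longrightarrow> moment c j (S n) = 0" and S0: "moment c 0 (S n) = h n"
    by auto
  have m1: "moment c (-1) (\<Phi> n) = - r (Suc n) * h n"
    and m2: "moment c (int n + 1) (S n) = - rb (Suc n) * h n"
    using h by (simp_all add: r_Suc rb_Suc)
  have orth: "moment c j (\<Phi> (Suc n)) = 0" if "0 \<le> j" "j < int (Suc n)" for j
  proof (cases "j = 0")
    case True
    then show ?thesis using moment_\<Phi>_step[of 0 n] m1 S0 by simp
  next
    case False
    then show ?thesis using moment_\<Phi>_step[of j n] \<Phi>[of "j - 1"] S[of j] that by simp
  qed
  have orth': "moment c j (S (Suc n)) = 0" if "1 \<le> j" "j \<le> int (Suc n)" for j
  proof (cases "j = int n + 1")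
    case True
    then show ?thesis using moment_S_step[of j n] m2 h_def[of n] by simp
  next
    case False
    then show ?thesis using moment_S_step[of j n] \<Phi>[of "j - 1"] S[of j] that by simp
  qed
  have hS: "h (Suc n) = h n + r (Suc n) * (- rb (Suc n) * h n)"
    using moment_\<Phi>_step[of "int n + 1" n] unfolding m2 h_def[of "Suc n"]
    by (simp add: h_def[of n] add.commute)
  then have S0': "moment c 0 (S (Suc n)) = h (Suc n)"
    using moment_S_step[of 0 n] S0 m1 by simp
  \<comment> \<open>The new norm is a quotient of consecutive determinants, hence nonzero.\<close>
  have "toeplitz c 0 (Suc (Suc n)) =
      (\<Sum>k\<le>Suc n. poly.coeff (\<Phi> (Suc n)) k * c (int (Suc n) - int k)) * toeplitz c 0 (Suc n)"
  proof (rule toeplitz_Suc)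
    fix j assume "j < Suc n"
    then show "(\<Sum>k\<le>Suc n. poly.coeff (\<Phi> (Suc n)) k * c (int j - int k)) = 0"
      using orth[of "int j"] moment_altdef[OF degree_\<Phi>, of c "int j" "Suc n"] by simp
  qed (rule coeff_\<Phi>_top)
  then have "h (Suc n) \<noteq> 0"
    using moment_altdef[OF degree_\<Phi>, of c "int (Suc n)" "Suc n"] toeplitz_nonzero[of "Suc (Suc n)"]
    unfolding h_def by force
  then show ?case using orth orth' S0' by blast
qed

lemma h_nonzero: "h n \<noteq> 0"
  and moment_\<Phi>: "0 \<le> j \<Longrightarrow> j < int n \<Longrightarrow> moment c j (\<Phi> n) = 0"
  and moment_S: "1 \<le> j \<Longrightarrow> j \<le> int n \<Longrightarrow> moment c j (S n) = 0"
  and moment_\<Phi>_top: "moment c (int n) (\<Phi> n) = h n"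
  and moment_S_0: "moment c 0 (S n) = h n"
  using orthogonal_h[of n] by (auto simp: h_def)

lemma moment_\<Phi>_minus_1: "moment c (-1) (\<Phi> n) = - r (Suc n) * h n"
  and moment_S_Suc: "moment c (int n + 1) (S n) = - rb (Suc n) * h n"
  using h_nonzero[of n] by (simp_all add: r_Suc rb_Suc)

lemma h_Suc: "h (Suc n) = h n * (1 - r (Suc n) * rb (Suc n))"
  using moment_\<Phi>_step[of "int n + 1" n] unfolding moment_S_Suc h_def[of "Suc n"]
  by (simp add: h_def[of n] algebra_simps)

lemma r_eq_toeplitz: "r n = (- 1) ^ n * toeplitz c 1 n / toeplitz c 0 n"
proof -
  have "(- 1) ^ n * toeplitz c 1 n = poly.coeff (\<Phi> n) 0 * toeplitz c 0 n"
    by (rule toeplitz_shift)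
      (use moment_\<Phi>[of _ n] moment_altdef[OF degree_\<Phi>, symmetric] in auto)
  then show ?thesis using toeplitz_nonzero[of n] by (simp add: r_def)
qed

text \<open>The coefficients of \<open>S n\<close> in reverse order form the monic orthogonal
  polynomial for the reflected sequence, whose constant coefficient is \<open>rb n\<close>. So
  \<open>toeplitz_shift\<close> applies to that sequence.\<close>

lemma rb_eq_toeplitz: "rb n = (- 1) ^ n * toeplitz c (- 1) n / toeplitz c 0 n"
proof -
  have "(\<Sum>k\<le>n. poly.coeff (S n) (n - k) * c (- (int j - int k))) = 0" if "j < n" for j
  proof -
    have "(\<Sum>k\<le>n. poly.coeff (S n) (n - k) * c (- (int j - int k))) =
        (\<Sum>i\<le>n. poly.coeff (S n) i * c (int n - int j - int i))"
      by (rule sum.reindex_bij_witness[of _ "\<lambda>i. n - i" "\<lambda>i. n - i"]) (use that in \<open>auto simp: of_nat_diff algebra_simps\<close>)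
    also have "\<dots> = 0"
      using moment_S[of "int n - int j" n] moment_altdef[OF degree_S, of c "int n - int j" n] that by auto
    finally show ?thesis .
  qed
  then have "(- 1) ^ n * toeplitz (\<lambda>k. c (- k)) 1 n = poly.coeff (S n) (n - 0) * toeplitz (\<lambda>k. c (- k)) 0 n"
    by (intro toeplitz_shift) auto
  then show ?thesis using toeplitz_nonzero[of n] by (simp add: rb_def toeplitz_reflect)
qed

end

section \<open>Recurrences for the reflection coefficients from the three-term relation of the
  moments\<close>

locale pearson_toeplitz_system = toeplitz_system +
  fixes \<mu> \<nu> t :: 'a
  assumes pearson: "(of_int k + \<nu>) * c k = (\<mu> - of_int k + 1 + t) * c (k - 1) + t * c (k - 2)"
begin

text \<open>Up to the factor \<open>\<i>\<close>, this is \<open>\<integral> d/d\<theta> ((1 + z) p(z) z\<^sup>-\<^sup>m w(z)) d\<theta> = 0\<close> written with moments.\<close>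

lemma pearson_poly:
  "moment c (m - 1) (pderiv p) + moment c (m - 2) (pderiv p) + t * moment c (m - 2) p
   + (\<mu> + 1 + t - of_int m) * moment c (m - 1) p - (\<nu> + of_int m) * moment c m p = 0"
proof (induction p arbitrary: m)
  case (pCons a p)
  have "moment c (m - 1) (pderiv (pCons a p)) + moment c (m - 2) (pderiv (pCons a p)) + t * moment c (m - 2) (pCons a p)
   + (\<mu> + 1 + t - of_int m) * moment c (m - 1) (pCons a p) - (\<nu> + of_int m) * moment c m (pCons a p)
   = a * ((\<mu> - of_int m + 1 + t) * c (m - 1) + t * c (m - 2) - (of_int m + \<nu>) * c m)
   + (moment c (m - 1 - 1) (pderiv p) + moment c (m - 1 - 2) (pderiv p) + t * moment c (m - 1 - 2) p
   + (\<mu> + 1 + t - of_int (m - 1)) * moment c (m - 1 - 1) p - (\<nu> + of_int (m - 1)) * moment c (m - 1) p)"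
    by (simp add: pderiv_pCons moment_simps algebra_simps)
  also have "\<dots> = 0" unfolding pCons.IH pearson by simp
  finally show ?case .
qed (simp add: moment_def)

text \<open>The next three relations are \<open>pearson_poly\<close> applied to the products
  \<open>\<Phi>\<^sub>n \<Phi>\<^sup>*\<^sub>n\<close>, \<open>\<Phi>\<^sub>n\<^sub>+\<^sub>1 \<Phi>\<^sub>n\<close> and \<open>\<Phi>\<^sup>*\<^sub>n\<^sub>+\<^sub>1 \<Phi>\<^sup>*\<^sub>n\<close>; the orthogonality leaves one term of each moment.\<close>

lemma subleading_coeff:
  "poly.coeff (S n) 1 = - (\<mu> + t) - (of_nat n + 1 + \<nu>) * rb (Suc n) * r n + t * r (Suc n) * rb n"
proof -
  \<comment> \<open>The moments of \<Phi>_n vanish on 0..n-1 and those of \<open>S n\<close> on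
    1..n. This value of \<open>?m\<close> lets every product below meet at most one nonzero
    moment.\<close>
  let ?m = "int n + 1"
  have 1: "moment c (?m - 1) (S n * pderiv (\<Phi> n)) = 0"
  proof -
    \<comment> \<open>The crude bound n also covers n = 0; the one exceptional index k = n meets a
      vanishing coefficient of the derivative.\<close>
    have "degree (pderiv (\<Phi> n)) \<le> n" using degree_\<Phi>[of n] by (simp add: degree_pderiv)
    then have "moment c (?m - 1) (S n * pderiv (\<Phi> n)) =
      poly.coeff (pderiv (\<Phi> n)) n * moment c (?m - 1 - int n) (S n)"
      by (rule moment_mult_single) (rule moment_S, auto)
    then show ?thesis using degree_\<Phi>[of n] by (simp add: coeff_pderiv coeff_eq_0)
  qed
  have 2: "moment c (?m - 2) (S n * pderiv (\<Phi> n)) = of_nat n * h n"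
  \<comment> \<open>Here the sharp bound n - 1 matters: admitting k = n would reach the moment of
    \<open>S n\<close> at -1, about which nothing is known. For n = 0 the derivative is 0.\<close>
  proof (cases n)
    case (Suc n')
    have "degree (pderiv (\<Phi> n)) \<le> n'" using Suc degree_\<Phi>[of n] by (simp add: degree_pderiv)
    then have "moment c (?m - 2) (S n * pderiv (\<Phi> n)) =
      poly.coeff (pderiv (\<Phi> n)) n' * moment c (?m - 2 - int n') (S n)"
      by (rule moment_mult_single) (rule moment_S, use Suc in auto)
    then show ?thesis using coeff_\<Phi>_top[of n] by (simp add: coeff_pderiv moment_S_0 Suc)
  qed simp
  have 3: "moment c (?m - 1) (\<Phi> n * pderiv (S n)) = poly.coeff (S n) 1 * h n"
  proof -
    have "degree (pderiv (S n)) \<le> n" using degree_S[of n] by (simp add: degree_pderiv)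
    then have "moment c (?m - 1) (\<Phi> n * pderiv (S n)) =
      poly.coeff (pderiv (S n)) 0 * moment c (?m - 1 - int 0) (\<Phi> n)"
      by (rule moment_mult_single) (rule moment_\<Phi>, auto)
    then show ?thesis by (simp add: coeff_pderiv moment_\<Phi>_top)
  qed
  have 4: "moment c (?m - 2) (\<Phi> n * pderiv (S n)) = 0"
  proof -
    have "degree (pderiv (S n)) \<le> n" using degree_S[of n] by (simp add: degree_pderiv)
    then have "moment c (?m - 2) (\<Phi> n * pderiv (S n)) =
      poly.coeff (pderiv (S n)) n * moment c (?m - 2 - int n) (\<Phi> n)"
      by (rule moment_mult_single) (rule moment_\<Phi>, auto)
    then show ?thesis using degree_S[of n] by (simp add: coeff_pderiv coeff_eq_0)
  qed
  have 5: "moment c (?m - 2) (\<Phi> n * S n) = - rb n * r (Suc n) * h n"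
  proof -
    have "moment c (?m - 2) (\<Phi> n * S n) = poly.coeff (S n) n * moment c (?m - 2 - int n) (\<Phi> n)"
      by (rule moment_mult_single[OF degree_S]) (rule moment_\<Phi>, auto)
    then show ?thesis by (simp add: moment_\<Phi>_minus_1 rb_def)
  qed
  have 6: "moment c (?m - 1) (\<Phi> n * S n) = h n"
  proof -
    have "moment c (?m - 1) (\<Phi> n * S n) = poly.coeff (S n) 0 * moment c (?m - 1 - int 0) (\<Phi> n)"
      by (rule moment_mult_single[OF degree_S]) (rule moment_\<Phi>, auto)
    then show ?thesis by (simp add: moment_\<Phi>_top)
  qed
  \<comment> \<open>Expanding in the moments of \<Phi>_n would leave two terms, at n + 1 and n. With
    the roles exchanged, only the moment of \<open>S n\<close> at n + 1 survives.\<close>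
  have 7: "moment c ?m (\<Phi> n * S n) = - r n * rb (Suc n) * h n"
  proof -
    have "moment c ?m (S n * \<Phi> n) = poly.coeff (\<Phi> n) 0 * moment c (?m - int 0) (S n)"
      by (rule moment_mult_single[OF degree_\<Phi>]) (rule moment_S, auto)
    then show ?thesis using moment_S_Suc[of n] by (simp add: r_def mult.commute[of "\<Phi> n"])
  qed
  have "h n * (poly.coeff (S n) 1 + (\<mu> + t) + (of_nat n + 1 + \<nu>) * rb (Suc n) * r n
      - t * r (Suc n) * rb n) = 0"
    using pearson_poly[of ?m "\<Phi> n * S n"]
    unfolding pderiv_mult moment_add 1 2 3 4 5 6 7
    by (simp add: algebra_simps)
  then have "poly.coeff (S n) 1 + (\<mu> + t) + (of_nat n + 1 + \<nu>) * rb (Suc n) * r n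
      - t * r (Suc n) * rb n = 0"
    using h_nonzero[of n] by simp
  then show ?thesis by (subst eq_iff_diff_eq_0) (simp add: algebra_simps)
qed

lemma \<Phi>_relation:
  "(poly.coeff (\<Phi> (Suc n)) 1 - of_nat (Suc n) * r (Suc n)) * h n =
   ((of_nat (Suc n) + \<nu>) * r n + t * r (Suc (Suc n))) * h (Suc n)"
proof -
  let ?m = "int n + 1"
  have d: "degree (pderiv (\<Phi> n)) \<le> n" "degree (pderiv (\<Phi> (Suc n))) \<le> n"
    using degree_\<Phi>[of n] degree_\<Phi>[of "Suc n"] by (simp_all add: degree_pderiv)
  have 1: "moment c (?m - 1) (\<Phi> n * pderiv (\<Phi> (Suc n))) = poly.coeff (\<Phi> (Suc n)) 1 * h n"
  proof -
    have "moment c (?m - 1) (\<Phi> n * pderiv (\<Phi> (Suc n))) =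
      poly.coeff (pderiv (\<Phi> (Suc n))) 0 * moment c (?m - 1 - int 0) (\<Phi> n)"
      by (rule moment_mult_single[OF d(2)]) (rule moment_\<Phi>, auto)
    then show ?thesis by (simp add: coeff_pderiv moment_\<Phi>_top)
  qed
  have 2: "moment c (?m - 2) (\<Phi> n * pderiv (\<Phi> (Suc n))) = - of_nat (Suc n) * r (Suc n) * h n"
  proof -
    have "moment c (?m - 2) (\<Phi> n * pderiv (\<Phi> (Suc n))) =
      poly.coeff (pderiv (\<Phi> (Suc n))) n * moment c (?m - 2 - int n) (\<Phi> n)"
      by (rule moment_mult_single[OF d(2)]) (rule moment_\<Phi>, auto)
    then show ?thesis by (simp add: coeff_pderiv moment_\<Phi>_minus_1 algebra_simps)
  qed
  have 3: "moment c j (\<Phi> (Suc n) * pderiv (\<Phi> n)) = 0" if "j = ?m - 1 \<or> j = ?m - 2" for j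
  proof -
    have "moment c j (\<Phi> (Suc n) * pderiv (\<Phi> n)) =
      poly.coeff (pderiv (\<Phi> n)) n * moment c (j - int n) (\<Phi> (Suc n))"
      by (rule moment_mult_single[OF d(1)]) (rule moment_\<Phi>, use that in auto)
    then show ?thesis using degree_\<Phi>[of n] by (simp add: coeff_pderiv coeff_eq_0)
  qed
  have 4: "moment c (?m - 2) (\<Phi> (Suc n) * \<Phi> n) = - r (Suc (Suc n)) * h (Suc n)"
  proof -
    have "moment c (?m - 2) (\<Phi> (Suc n) * \<Phi> n) = poly.coeff (\<Phi> n) n * moment c (?m - 2 - int n) (\<Phi> (Suc n))"
      by (rule moment_mult_single[OF degree_\<Phi>]) (rule moment_\<Phi>, auto)
    then show ?thesis by (simp add: moment_\<Phi>_minus_1)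
  qed
  \<comment> \<open>This is the moment that \<mu> multiplies, so \<mu> disappears from the relation;
    it returns through \<open>subleading_coeff\<close>.\<close>
  have 5: "moment c (?m - 1) (\<Phi> (Suc n) * \<Phi> n) = 0"
  proof -
    have "moment c (?m - 1) (\<Phi> (Suc n) * \<Phi> n) = poly.coeff (\<Phi> n) n * moment c (?m - 1 - int n) (\<Phi> (Suc n))"
      by (rule moment_mult_single[OF degree_\<Phi>]) (rule moment_\<Phi>, auto)
    then show ?thesis by (simp add: moment_\<Phi>)
  qed
  have 6: "moment c ?m (\<Phi> (Suc n) * \<Phi> n) = r n * h (Suc n)"
  proof -
    have "moment c ?m (\<Phi> (Suc n) * \<Phi> n) = poly.coeff (\<Phi> n) 0 * moment c (?m - int 0) (\<Phi> (Suc n))"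
      by (rule moment_mult_single[OF degree_\<Phi>]) (rule moment_\<Phi>, auto)
    then show ?thesis using moment_\<Phi>_top[of "Suc n"] by (simp add: r_def add.commute)
  qed
  show ?thesis
    using pearson_poly[of ?m "\<Phi> (Suc n) * \<Phi> n"] 3
    unfolding pderiv_mult moment_add 1 2 4 5 6
    by (simp add: algebra_simps)
qed

lemma S_relation:
  "t * rb n * h (Suc n) + (of_nat (Suc n) + 1 + \<nu>) * rb (Suc (Suc n)) * h (Suc n) +
   (of_nat (Suc n) - poly.coeff (S (Suc n)) 1) * rb (Suc n) * h n = 0"
proof -
  \<comment> \<open>One more than for \<Phi>, since the range of vanishing moments of
    \<open>S\<close> is shifted up by one.\<close>
  let ?m = "int n + 2"
  have d: "degree (pderiv (S n)) \<le> n" "degree (pderiv (S (Suc n))) \<le> n"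
    using degree_S[of n] degree_S[of "Suc n"] by (simp_all add: degree_pderiv)
  have 1: "moment c (?m - 1) (S n * pderiv (S (Suc n))) = - poly.coeff (S (Suc n)) 1 * rb (Suc n) * h n"
  proof -
    have "moment c (?m - 1) (S n * pderiv (S (Suc n))) =
      poly.coeff (pderiv (S (Suc n))) 0 * moment c (?m - 1 - int 0) (S n)"
      by (rule moment_mult_single[OF d(2)]) (rule moment_S, auto)
    then show ?thesis using moment_S_Suc[of n] by (simp add: coeff_pderiv add.commute)
  qed
  have 2: "moment c (?m - 2) (S n * pderiv (S (Suc n))) = of_nat (Suc n) * rb (Suc n) * h n"
  proof -
    have "moment c (?m - 2) (S n * pderiv (S (Suc n))) =
      poly.coeff (pderiv (S (Suc n))) n * moment c (?m - 2 - int n) (S n)"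
      by (rule moment_mult_single[OF d(2)]) (rule moment_S, auto)
    then show ?thesis by (simp add: coeff_pderiv moment_S_0 rb_def)
  qed
  have 3: "moment c j (S (Suc n) * pderiv (S n)) = 0" if "j = ?m - 1 \<or> j = ?m - 2" for j
  proof -
    have "moment c j (S (Suc n) * pderiv (S n)) =
      poly.coeff (pderiv (S n)) n * moment c (j - int n) (S (Suc n))"
      by (rule moment_mult_single[OF d(1)]) (rule moment_S, use that in auto)
    then show ?thesis using degree_S[of n] by (simp add: coeff_pderiv coeff_eq_0)
  qed
  have 4: "moment c (?m - 2) (S (Suc n) * S n) = rb n * h (Suc n)"
  proof -
    have "moment c (?m - 2) (S (Suc n) * S n) = poly.coeff (S n) n * moment c (?m - 2 - int n) (S (Suc n))"
      by (rule moment_mult_single[OF degree_S]) (rule moment_S, auto)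
    then show ?thesis by (simp add: moment_S_0 rb_def)
  qed
  have 5: "moment c (?m - 1) (S (Suc n) * S n) = 0"
  proof -
    have "moment c (?m - 1) (S (Suc n) * S n) = poly.coeff (S n) n * moment c (?m - 1 - int n) (S (Suc n))"
      by (rule moment_mult_single[OF degree_S]) (rule moment_S, auto)
    then show ?thesis by (simp add: moment_S)
  qed
  have 6: "moment c ?m (S (Suc n) * S n) = - rb (Suc (Suc n)) * h (Suc n)"
  proof -
    have "moment c ?m (S (Suc n) * S n) = poly.coeff (S n) 0 * moment c (?m - int 0) (S (Suc n))"
      by (rule moment_mult_single[OF degree_S]) (rule moment_S, auto)
    then show ?thesis using moment_S_Suc[of "Suc n"] by (simp add: add.commute)
  qed
  show ?thesis
    using pearson_poly[of ?m "S (Suc n) * S n"] 3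
    unfolding pderiv_mult moment_add 1 2 4 5 6
    by (simp add: algebra_simps)
qed

text \<open>Dividing \<open>\<Phi>_relation\<close> by \<open>h n\<close> leaves the coefficient of
  z in \<Phi>_(n+1), which the Szego step reduces to that of \<open>S n\<close>. Inserting
  \<open>subleading_coeff\<close> cancels the products of \<open>r n\<close>,
  \<open>r (Suc n)\<close> and \<open>rb (Suc n)\<close>.\<close>

theorem r_recurrence:
  "(of_nat n + \<nu>) * r n + (of_nat (Suc n) + \<mu> + t) * r (Suc n) =
   - t * (1 - r (Suc n) * rb (Suc n)) * r (Suc (Suc n)) + t * (r (Suc n))\<^sup>2 * rb n"
proof -
  have "h n * (poly.coeff (\<Phi> (Suc n)) 1 - of_nat (Suc n) * r (Suc n)) =
      h n * ((1 - r (Suc n) * rb (Suc n)) * ((of_nat (Suc n) + \<nu>) * r n + t * r (Suc (Suc n))))"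
    using \<Phi>_relation[of n] unfolding h_Suc by (simp add: ac_simps)
  then have "r n + r (Suc n) * poly.coeff (S n) 1 - of_nat (Suc n) * r (Suc n) =
      (1 - r (Suc n) * rb (Suc n)) * ((of_nat (Suc n) + \<nu>) * r n + t * r (Suc (Suc n)))"
    unfolding coeff_\<Phi>_Suc_1 using h_nonzero[of n] by simp
  then have "(1 - r (Suc n) * rb (Suc n)) * ((of_nat (Suc n) + \<nu>) * r n + t * r (Suc (Suc n))) -
      (r n + r (Suc n) * poly.coeff (S n) 1 - of_nat (Suc n) * r (Suc n)) = 0"
    by simp
  then show ?thesis
    unfolding subleading_coeff by (subst eq_iff_diff_eq_0) (simp add: power2_eq_square algebra_simps)
qed

text \<open>The same elimination in \<open>S_relation\<close>, now with
  \<open>subleading_coeff\<close> at n + 1 instead of n.\<close>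

theorem rb_recurrence:
  "(of_nat (Suc n) + 1 + \<nu>) * rb (Suc (Suc n)) + (of_nat (Suc n) + \<mu> + t) * rb (Suc n) =
   - t * (1 - r (Suc n) * rb (Suc n)) * rb n + t * (rb (Suc n))\<^sup>2 * r (Suc (Suc n))"
proof -
  have "h n * ((1 - r (Suc n) * rb (Suc n)) * (t * rb n + (of_nat (Suc n) + 1 + \<nu>) * rb (Suc (Suc n))) +
      (of_nat (Suc n) - poly.coeff (S (Suc n)) 1) * rb (Suc n)) = 0"
    using S_relation[of n] unfolding h_Suc by (simp add: algebra_simps)
  then have "(1 - r (Suc n) * rb (Suc n)) * (t * rb n + (of_nat (Suc n) + 1 + \<nu>) * rb (Suc (Suc n))) +
      (of_nat (Suc n) - poly.coeff (S (Suc n)) 1) * rb (Suc n) = 0"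
    using h_nonzero[of n] by simp
  then show ?thesis
    unfolding subleading_coeff by (subst eq_iff_diff_eq_0) (simp add: power2_eq_square algebra_simps)
qed

end

section \<open>Fourier coefficients of the weight\<close>

text \<open>Jordan's inequality: a concave function lies above its chord.\<close>

lemma sin_ge_linear:
  fixes x :: real
  assumes "0 \<le> x" "x \<le> pi / 2"
  shows "2 * x / pi \<le> sin x"
proof -
  have "convex_on {0..pi/2} (\<lambda>x. - sin x)"
    by (rule f''_ge0_imp_convex[where f' = "\<lambda>x. - cos x" and f'' = sin])
      (auto intro!: derivative_eq_intros sin_ge_zero)
  from convex_onD_Icc'[OF this, of x] assms show ?thesis
    by (simp add: field_simps)
qed

lemma cos_half_ge_linear:
  fixes \<theta> :: real
  assumes "\<bar>\<theta>\<bar> \<le> pi"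
  shows "(pi - \<bar>\<theta>\<bar>) / pi \<le> cos (\<theta> / 2)"
proof -
  have "sin ((pi - \<bar>\<theta>\<bar>) / 2) = cos (\<bar>\<theta>\<bar> / 2)"
    by (simp add: cos_sin_eq diff_divide_distrib)
  moreover have "cos (\<bar>\<theta>\<bar> / 2) = cos (\<theta> / 2)"
    by (cases "\<theta> \<ge> 0") auto
  ultimately show ?thesis
    using sin_ge_linear[of "(pi - \<bar>\<theta>\<bar>) / 2"] assms by (simp add: field_simps)
qed

lemma cos_half_pos: "\<bar>\<theta>\<bar> < pi \<Longrightarrow> cos (\<theta> / 2) > 0" for \<theta> :: real
  by (intro cos_gt_zero_pi) auto

lemma cos_half_nonneg: "\<bar>\<theta>\<bar> \<le> pi \<Longrightarrow> cos (\<theta> / 2) \<ge> 0" for \<theta> :: real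
  by (intro cos_ge_zero) auto

text \<open>For negative \<open>s\<close> the singularities at both endpoints are dominated by
  powers of the distance to them, by \<open>cos_half_ge_linear\<close>; for positive
  \<open>s\<close> the integrand is continuous.\<close>

lemma integrable_cos_half_powr:
  assumes s: "s > -1"
  shows "(\<lambda>\<theta>. cos (\<theta> / 2) powr s) integrable_on {-pi..pi}"
proof (cases "s \<ge> 0")
  case True
  have "(\<lambda>\<theta>. cos (\<theta> / 2) powr s) integrable_on {-pi<..<pi}"
  \<comment> \<open>Since \<open>0 powr 0 = 0\<close>, the case s = 0 jumps at the endpoints; on the
    open interval the integrand is constant.\<close>
  proof (cases "s = 0")
    case True
    have "(\<lambda>\<theta>. cos (\<theta> / 2) powr s) integrable_on {-pi<..<pi} \<longleftrightarrow>
        (\<lambda>\<theta>. 1::real) integrable_on {-pi<..<pi}"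
      by (rule integrable_cong) (use True cos_half_pos in \<open>force simp: abs_less_iff\<close>)
    then show ?thesis by (simp add: integrable_on_Icc_iff_Ioo[symmetric] integrable_const_ivl)
  next
    case False
    with True have "continuous_on {-pi..pi} (\<lambda>\<theta>. cos (\<theta> / 2) powr s)"
      by (intro continuous_on_powr' continuous_intros) (auto intro!: cos_ge_zero)
    then show ?thesis
      using integrable_continuous_interval integrable_on_Icc_iff_Ioo by blast
  qed
  then show ?thesis by (simp add: integrable_on_Icc_iff_Ioo)
next
  case False
  then have neg: "s < 0" by simp
  have pow: "(\<lambda>x. (x / pi) powr s) integrable_on {0..2 * pi}"
  proof -
    have "(\<lambda>x. x powr s * (1 / pi) powr s) integrable_on {0..2 * pi}"
      using integrable_on_powr_from_0[OF s, of "2 * pi"] by (intro integrable_on_mult_left) simp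
    moreover have "x powr s * (1 / pi) powr s = (x / pi) powr s" if "x \<in> {0..2 * pi}" for x
      using that by (simp add: powr_mult[symmetric])
    ultimately show ?thesis by (rule integrable_eq) 
  qed
  have plus: "(\<lambda>\<theta>. ((pi + \<theta>) / pi) powr s) integrable_on {-pi..pi}"
    using integrable_on_shift_Icc_real[of "\<lambda>x. (x / pi) powr s" pi "-pi" pi] pow
    by (simp add: o_def)
  then have minus: "(\<lambda>\<theta>. ((pi - \<theta>) / pi) powr s) integrable_on {-pi..pi}"
    using Henstock_Kurzweil_Integration.integrable_reflect_real[of "\<lambda>\<theta>. ((pi + \<theta>) / pi) powr s" pi "-pi"] by simp
  have "(\<lambda>\<theta>. cos (\<theta> / 2) powr s) absolutely_integrable_on {-pi<..<pi}"
  proof (rule measurable_bounded_by_integrable_imp_absolutely_integrable)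
    show "(\<lambda>\<theta>. cos (\<theta> / 2) powr s) \<in> borel_measurable (lebesgue_on {-pi<..<pi})"
    proof (rule continuous_imp_measurable_on_sets_lebesgue)
      show "continuous_on {-pi<..<pi} (\<lambda>\<theta>. cos (\<theta> / 2) powr s)"
        by (intro continuous_intros ballI less_imp_neq[THEN not_sym] cos_half_pos) auto
    qed simp
    show "(\<lambda>\<theta>. ((pi + \<theta>) / pi) powr s + ((pi - \<theta>) / pi) powr s) integrable_on {-pi<..<pi}"
      using integrable_add[OF plus minus] by (simp add: integrable_on_Icc_iff_Ioo)
    fix \<theta> assume \<theta>: "\<theta> \<in> {-pi<..<pi}"
    then have "cos (\<theta> / 2) powr s \<le> ((pi - \<bar>\<theta>\<bar>) / pi) powr s"
      using cos_half_ge_linear[of \<theta>] neg by (intro powr_mono2') auto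
    also have "\<dots> \<le> ((pi + \<theta>) / pi) powr s + ((pi - \<theta>) / pi) powr s"
      by (cases "\<theta> \<ge> 0") auto
    finally show "norm (cos (\<theta> / 2) powr s) \<le> ((pi + \<theta>) / pi) powr s + ((pi - \<theta>) / pi) powr s"
      by simp
  qed simp
  then show ?thesis
    using integrable_on_Icc_iff_Ioo set_lebesgue_integral_eq_integral(1) by blast
qed

lemma one_plus_cis: "1 + cis \<theta> = of_real (2 * cos (\<theta> / 2)) * exp (\<i> * of_real \<theta> / 2)"
proof -
  have "1 + cis \<theta> = cis (\<theta> / 2) * (cis (- \<theta> / 2) + cis (\<theta> / 2))"
    by (simp add: distrib_left cis_mult)
  also have "cis (- \<theta> / 2) + cis (\<theta> / 2) = of_real (2 * cos (\<theta> / 2))"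
    by (simp add: complex_eq_iff)
  finally show ?thesis by (simp add: cis_conv_exp mult.commute)
qed

lemma circle_weight_altdef:
  assumes "\<bar>\<theta>\<bar> \<le> pi"
  shows "circle_weight \<mu> \<nu> t \<theta> = exp (\<i> * of_real \<theta> * (\<mu> - \<nu>) / 2) *
    of_real (2 * cos (\<theta> / 2)) powr (\<mu> + \<nu>) * exp (t * cis \<theta>)"
proof -
  have "cmod (1 + cis \<theta>) = 2 * cos (\<theta> / 2)"
    unfolding one_plus_cis using cos_half_nonneg[OF assms] by (simp add: norm_mult)
  then show ?thesis by (simp add: circle_weight_def)
qed

text \<open>A single exponential on the open interval makes continuity and differentiation in
  \<theta> immediate.\<close>

lemma circle_weight_exp:
  assumes "\<bar>\<theta>\<bar> < pi"
  shows "circle_weight \<mu> \<nu> t \<theta> = exp (\<i> * of_real \<theta> * (\<mu> - \<nu>) / 2 +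
    (\<mu> + \<nu>) * of_real (ln (2 * cos (\<theta> / 2))) + t * exp (\<i> * of_real \<theta>))"
proof -
  have c: "2 * cos (\<theta> / 2) > 0" using cos_half_pos[OF assms] by simp
  have "of_real (2 * cos (\<theta> / 2)) powr (\<mu> + \<nu>) = exp ((\<mu> + \<nu>) * of_real (ln (2 * cos (\<theta> / 2))))"
    unfolding powr_def using Ln_of_real[OF c] c by auto
  then show ?thesis
    using assms by (subst circle_weight_altdef) (simp_all add: exp_add cis_conv_exp)
qed

lemma circle_weight_Suc:
  assumes "\<bar>\<theta>\<bar> \<le> pi"
  shows "circle_weight (\<mu> + 1) \<nu> t \<theta> = (1 + cis \<theta>) * circle_weight \<mu> \<nu> t \<theta>"
proof (cases "cos (\<theta> / 2) = 0")
  case True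
  then show ?thesis using assms by (simp add: circle_weight_altdef)
next
  case False
  have "of_real (2 * cos (\<theta> / 2)) powr (\<mu> + \<nu> + 1) =
      of_real (2 * cos (\<theta> / 2)) * of_real (2 * cos (\<theta> / 2)) powr (\<mu> + \<nu>)"
    using False by (simp add: powr_add)
  moreover have "exp (\<i> * of_real \<theta> * (\<mu> + 1 - \<nu>) / 2) =
      exp (\<i> * of_real \<theta> / 2) * exp (\<i> * of_real \<theta> * (\<mu> - \<nu>) / 2)"
    unfolding exp_add[symmetric] by (rule arg_cong[where f = exp]) (simp add: field_simps)
  ultimately show ?thesis
    using assms by (simp add: circle_weight_altdef one_plus_cis algebra_simps)
qed

text \<open>Allowing any \<open>s\<close> below the real part gives one majorant for all \<mu> near
  a given point, since the cosine is at most 1. The constants come from \<pi> < 4 and ln 2 <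
  1.\<close>

lemma norm_circle_weight_le:
  assumes \<theta>: "\<bar>\<theta>\<bar> \<le> pi" and s: "s \<le> Re (\<mu> + \<nu>)"
  shows "norm (circle_weight \<mu> \<nu> t \<theta>) \<le> exp (4 * (norm \<mu> + norm \<nu>) + norm t) * cos (\<theta> / 2) powr s"
proof (cases "cos (\<theta> / 2) = 0")
  case True
  then show ?thesis using \<theta> by (simp add: circle_weight_altdef)
next
  case False
  then have c: "0 < cos (\<theta> / 2)" using cos_half_nonneg[OF \<theta>] by simp
  have 1: "norm (exp (\<i> * of_real \<theta> * (\<mu> - \<nu>) / 2)) \<le> exp (2 * (norm \<mu> + norm \<nu>))"
  proof -
    have "norm (\<i> * of_real \<theta> * (\<mu> - \<nu>) / 2) \<le> pi * (norm \<mu> + norm \<nu>) / 2"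
      using \<theta> by (auto simp: norm_mult norm_divide intro!: mult_mono norm_triangle_ineq4)
    also have "\<dots> \<le> 2 * (norm \<mu> + norm \<nu>)"
      using mult_right_mono[of pi 4 "norm \<mu> + norm \<nu>"] pi_less_4 by simp
    finally show ?thesis using norm_exp[of "\<i> * of_real \<theta> * (\<mu> - \<nu>) / 2"] by (simp add: order.trans)
  qed
  have 2: "norm (of_real (2 * cos (\<theta> / 2)) powr (\<mu> + \<nu>)) \<le>
      exp (2 * (norm \<mu> + norm \<nu>)) * cos (\<theta> / 2) powr s"
  proof -
    have "norm (of_real (2 * cos (\<theta> / 2)) powr (\<mu> + \<nu>)) = 2 powr Re (\<mu> + \<nu>) * cos (\<theta> / 2) powr Re (\<mu> + \<nu>)"
      using c by (subst norm_powr_real_powr) (auto simp: powr_mult)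
    also have "\<dots> \<le> exp (2 * (norm \<mu> + norm \<nu>)) * cos (\<theta> / 2) powr s"
    proof (rule mult_mono)
      have "Re (\<mu> + \<nu>) * ln 2 \<le> norm (\<mu> + \<nu>) * 1"
        using ln_2_less_1 by (intro mult_mono complex_Re_le_cmod) auto
      also have "\<dots> \<le> 2 * (norm \<mu> + norm \<nu>)"
        using norm_triangle_ineq[of \<mu> \<nu>] norm_ge_zero[of \<mu>] norm_ge_zero[of \<nu>] unfolding mult_1_right distrib_left by linarith
      finally show "2 powr Re (\<mu> + \<nu>) \<le> exp (2 * (norm \<mu> + norm \<nu>))"
        by (simp add: powr_def)
      show "cos (\<theta> / 2) powr Re (\<mu> + \<nu>) \<le> cos (\<theta> / 2) powr s"
        using c s by (intro powr_mono') auto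
    qed auto
    finally show ?thesis .
  qed
  have 3: "norm (exp (t * cis \<theta>)) \<le> exp (norm t)"
    using norm_exp[of "t * cis \<theta>"] by (simp add: norm_mult)
  have "norm (circle_weight \<mu> \<nu> t \<theta>) \<le>
      exp (2 * (norm \<mu> + norm \<nu>)) * (exp (2 * (norm \<mu> + norm \<nu>)) * cos (\<theta> / 2) powr s) * exp (norm t)"
    unfolding circle_weight_altdef[OF \<theta>] norm_mult
    by (intro mult_mono 1 2 3) auto
  also have "\<dots> = exp (4 * (norm \<mu> + norm \<nu>) + norm t) * cos (\<theta> / 2) powr s"
    by (simp add: exp_add[symmetric] mult_exp_exp ac_simps)
  finally show ?thesis .
qed

lemma norm_exp_mode [simp]: "norm (exp (- \<i> * of_int k * of_real \<theta>)) = 1"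
  by (simp add: norm_exp_eq_Re)

lemma integrable_circle_weight:
  assumes "Re (\<mu> + \<nu>) > -1"
  shows "(\<lambda>\<theta>. circle_weight \<mu> \<nu> t \<theta> * exp (- \<i> * of_int k * of_real \<theta>)) integrable_on {-pi..pi}"
proof -
  let ?f = "\<lambda>\<theta>. circle_weight \<mu> \<nu> t \<theta> * exp (- \<i> * of_int k * of_real \<theta>)"
  let ?K = "exp (4 * (norm \<mu> + norm \<nu>) + norm t)"
  have "?f absolutely_integrable_on {-pi<..<pi}"
  proof (rule measurable_bounded_by_integrable_imp_absolutely_integrable)
    have "continuous_on {-pi<..<pi} (\<lambda>\<theta>. exp (\<i> * of_real \<theta> * (\<mu> - \<nu>) / 2 +
        (\<mu> + \<nu>) * of_real (ln (2 * cos (\<theta> / 2))) + t * exp (\<i> * of_real \<theta>)) *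
        exp (- \<i> * of_int k * of_real \<theta>))"
      using cos_half_pos by (intro continuous_intros) (force simp: abs_less_iff)+
    also have "?this \<longleftrightarrow> continuous_on {-pi<..<pi} ?f"
      by (intro continuous_on_cong) (auto simp: circle_weight_exp)
    finally show "?f \<in> borel_measurable (lebesgue_on {-pi<..<pi})"
      by (rule continuous_imp_measurable_on_sets_lebesgue) simp
    show "(\<lambda>\<theta>. ?K * cos (\<theta> / 2) powr Re (\<mu> + \<nu>)) integrable_on {-pi<..<pi}"
      using integrable_cos_half_powr[OF assms]
      by (intro integrable_on_mult_right) (simp add: integrable_on_Icc_iff_Ioo)
    show "norm (?f \<theta>) \<le> ?K * cos (\<theta> / 2) powr Re (\<mu> + \<nu>)" if "\<theta> \<in> {-pi<..<pi}" for \<theta>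
      using norm_circle_weight_le[of \<theta> "Re (\<mu> + \<nu>)" \<mu> \<nu> t] that
      by (simp add: norm_mult abs_le_iff)
  qed simp
  then show ?thesis
    using integrable_on_Icc_iff_Ioo set_lebesgue_integral_eq_integral(1) by blast
qed

section \<open>Dependence of the Fourier coefficients on t, \<mu> and the index\<close>

lemma fourier_coeff_circle_weight_sums:
  assumes "Re (\<mu> + \<nu>) > -1"
  shows "(\<lambda>n. t ^ n / fact n * fourier_coeff (circle_weight \<mu> \<nu> 0) (k - int n)) sums
    fourier_coeff (circle_weight \<mu> \<nu> t) k"
proof -
  define f where "f = (\<lambda>j \<theta>. circle_weight \<mu> \<nu> 0 \<theta> * exp (- \<i> * of_int j * of_real \<theta>))"
  define K where "K = exp (4 * (norm \<mu> + norm \<nu>)) * exp (norm t)"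
  have f_int: "f j integrable_on {-pi..pi}" for j
    unfolding f_def by (rule integrable_circle_weight) fact
  \<comment> \<open>Lowering the index multiplies the integrand by a power of z, so the series of
    e^(tz) becomes a series of shifted coefficients. Its partial sums are at most e^|t| in modulus,
    which gives the majorant.\<close>
  have fk: "f (k - int n) \<theta> = f k \<theta> * cis \<theta> ^ n" for n \<theta>
  proof -
    have "exp (- \<i> * of_int (k - int n) * of_real \<theta>) = exp (- \<i> * of_int k * of_real \<theta>) * exp (of_nat n * (\<i> * of_real \<theta>))"
      unfolding exp_add[symmetric] by (rule arg_cong[where f = exp]) (simp add: algebra_simps)
    then show ?thesis by (simp add: f_def exp_of_nat_mult cis_conv_exp)
  qed
  have "(\<lambda>n. integral {-pi..pi} (\<lambda>\<theta>. \<Sum>j<n. t ^ j / fact j * f (k - int j) \<theta>)) \<longlonglongrightarrow>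
      integral {-pi..pi} (\<lambda>\<theta>. circle_weight \<mu> \<nu> t \<theta> * exp (- \<i> * of_int k * of_real \<theta>))"
  proof (rule dominated_convergence(2))
    show "(\<lambda>\<theta>. \<Sum>j<n. t ^ j / fact j * f (k - int j) \<theta>) integrable_on {-pi..pi}" for n
      by (intro integrable_sum integrable_on_mult_right f_int) auto
    show "(\<lambda>\<theta>. K * cos (\<theta> / 2) powr Re (\<mu> + \<nu>)) integrable_on {-pi..pi}"
      by (intro integrable_on_mult_right integrable_cos_half_powr assms)
    fix \<theta> assume "\<theta> \<in> {-pi..pi}"
    then have \<theta>: "\<bar>\<theta>\<bar> \<le> pi" by auto
    have *: "(\<Sum>j<n. t ^ j / fact j * f (k - int j) \<theta>) = f k \<theta> * (\<Sum>j<n. (t * cis \<theta>) ^ j /\<^sub>R fact j)" for n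
      by (simp add: fk sum_distrib_left power_mult_distrib scaleR_conv_of_real field_simps)
    have "norm (\<Sum>j<n. (t * cis \<theta>) ^ j /\<^sub>R fact j) \<le> exp (norm t)" for n
    proof -
      have "norm (\<Sum>j<n. (t * cis \<theta>) ^ j /\<^sub>R fact j) \<le> (\<Sum>j<n. norm t ^ j /\<^sub>R fact j)"
        by (rule order_trans[OF norm_sum]) (simp add: norm_mult norm_power)
      also have "\<dots> \<le> exp (norm t)"
        using sum_le_suminf[OF summable_exp_generic[of "norm t"], of "{..<n}"] by (simp add: exp_def)
      finally show ?thesis .
    qed
    then have "norm (f k \<theta>) * norm (\<Sum>j<n. (t * cis \<theta>) ^ j /\<^sub>R fact j) \<le>
        (exp (4 * (norm \<mu> + norm \<nu>)) * cos (\<theta> / 2) powr Re (\<mu> + \<nu>)) * exp (norm t)" for n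
      using norm_circle_weight_le[OF \<theta>, of "Re (\<mu> + \<nu>)" \<mu> \<nu> 0]
      by (intro mult_mono) (auto simp: f_def norm_mult)
    then show "norm (\<Sum>j<n. t ^ j / fact j * f (k - int j) \<theta>) \<le> K * cos (\<theta> / 2) powr Re (\<mu> + \<nu>)" for n
      unfolding * norm_mult by (simp add: K_def ac_simps)
    have "(\<lambda>n. f k \<theta> * (\<Sum>j<n. (t * cis \<theta>) ^ j /\<^sub>R fact j)) \<longlonglongrightarrow> f k \<theta> * exp (t * cis \<theta>)"
      using exp_converges[of "t * cis \<theta>"] by (intro tendsto_intros) (simp add: sums_def)
    then show "(\<lambda>n. \<Sum>j<n. t ^ j / fact j * f (k - int j) \<theta>) \<longlonglongrightarrow>
        circle_weight \<mu> \<nu> t \<theta> * exp (- \<i> * of_int k * of_real \<theta>)"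
      unfolding * by (simp add: f_def circle_weight_def ac_simps)
  qed
  also have "(\<lambda>n. integral {-pi..pi} (\<lambda>\<theta>. \<Sum>j<n. t ^ j / fact j * f (k - int j) \<theta>)) =
      (\<lambda>n. \<Sum>j<n. t ^ j / fact j * integral {-pi..pi} (f (k - int j)))"
    using f_int by (subst integral_sum) (auto intro: integrable_on_mult_right)
  finally have "(\<lambda>n. t ^ n / fact n * integral {-pi..pi} (f (k - int n))) sums
      integral {-pi..pi} (\<lambda>\<theta>. circle_weight \<mu> \<nu> t \<theta> * exp (- \<i> * of_int k * of_real \<theta>))"
    by (simp add: sums_def)
  from sums_mult[OF this, of "1 / (2 * of_real pi)"] show ?thesis
    by (simp add: fourier_coeff_def f_def ac_simps)
qed

lemma isCont_fourier_coeff_circle_weight: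
  assumes "Re (\<mu> + \<nu>) > -1"
  shows "isCont (\<lambda>m. fourier_coeff (circle_weight m \<nu> t) k) \<mu>"
proof -
  \<comment> \<open>Room between -1 and the real part gives an open set \<open>A\<close> around
    \<mu>, bounded by \<open>R\<close>, on which one integrable majorant with exponent
    \<open>s\<close> serves all weights.\<close>
  obtain s where s: "-1 < s" "s < Re (\<mu> + \<nu>)"
    using dense[OF assms] by blast
  define R where "R = norm \<mu> + 1"
  define A where "A = {m. s < Re (m + \<nu>)} \<inter> ball 0 R"
  have "open A"
    unfolding A_def by (intro open_Int open_ball open_Collect_less continuous_intros)
  have "\<mu> \<in> A" using s by (simp add: A_def R_def)
  let ?g = "\<lambda>m \<theta>. circle_weight m \<nu> t \<theta> * exp (- \<i> * of_int k * of_real \<theta>)"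
  let ?K = "exp (4 * (R + norm \<nu>) + norm t)"
  have "continuous_on A (\<lambda>m. integral {-pi..pi} (?g m))"
    unfolding continuous_on_sequentially o_def
  proof safe
    fix X m assume X: "\<forall>n. X n \<in> A" "X \<longlonglongrightarrow> m" and "m \<in> A"
    show "(\<lambda>n. integral {-pi..pi} (?g (X n))) \<longlonglongrightarrow> integral {-pi..pi} (?g m)"
    proof (rule dominated_convergence(2))
      show "?g (X n) integrable_on {-pi..pi}" for n
        using X(1) s(1) by (intro integrable_circle_weight) (auto simp: A_def intro: less_trans)
      show "(\<lambda>\<theta>. ?K * cos (\<theta> / 2) powr s) integrable_on {-pi..pi}"
        by (intro integrable_on_mult_right integrable_cos_half_powr s)
      fix \<theta> assume "\<theta> \<in> {-pi..pi}"
      then have \<theta>: "\<bar>\<theta>\<bar> \<le> pi" by auto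
      have "norm (circle_weight (X n) \<nu> t \<theta>) \<le> ?K * cos (\<theta> / 2) powr s" for n
      proof -
        have Xn: "s \<le> Re (X n + \<nu>)" "norm (X n) \<le> R" using X(1) by (auto simp: A_def less_imp_le)
        show ?thesis
          by (rule order_trans[OF norm_circle_weight_le[OF \<theta> Xn(1)]])
            (use Xn(2) in \<open>auto intro!: mult_right_mono\<close>)
      qed
      then show "norm (?g (X n) \<theta>) \<le> ?K * cos (\<theta> / 2) powr s" for n
        by (simp add: norm_mult)
      have lim: "(\<lambda>n. of_real (2 * cos (\<theta> / 2)) powr (X n + \<nu>)) \<longlonglongrightarrow>
          (of_real (2 * cos (\<theta> / 2)) powr (m + \<nu>) :: complex)"
        unfolding powr_def using X(2) by (auto intro!: tendsto_intros)
      then show "(\<lambda>n. ?g (X n) \<theta>) \<longlonglongrightarrow> ?g m \<theta>"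
        unfolding circle_weight_altdef[OF \<theta>] by (intro tendsto_mult lim tendsto_exp tendsto_divide tendsto_diff tendsto_const X(2)) simp
    qed
  qed
  then have "isCont (\<lambda>m. integral {-pi..pi} (?g m)) \<mu>"
    using \<open>open A\<close> \<open>\<mu> \<in> A\<close> by (simp add: continuous_on_eq_continuous_at)
  then show ?thesis
    unfolding fourier_coeff_def by (intro continuous_intros)
qed

text \<open>The extra factor 1 + z raises the exponent, so \<open>V\<close> is continuous up to the
  endpoints and vanishes there; hence its derivative integrates to 0.\<close>

lemma fourier_coeff_circle_weight_pearson:
  fixes t :: complex
  assumes "Re (\<mu> + \<nu>) > -1"
  defines "w \<equiv> fourier_coeff (circle_weight \<mu> \<nu> t)"
  shows "(of_int k + \<nu>) * w k = (\<mu> - of_int k + 1 + t) * w (k - 1) + t * w (k - 2)"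
proof -
  define V where "V = (\<lambda>\<theta>. circle_weight (\<mu> + 1) \<nu> t \<theta> * exp (- \<i> * of_int k * of_real \<theta>))"
  define f where "f = (\<lambda>j \<theta>. circle_weight \<mu> \<nu> t \<theta> * exp (- \<i> * of_int j * of_real \<theta>))"
  define V' where "V' = (\<lambda>\<theta>. \<i> * ((\<mu> - of_int k + 1 + t) * f (k - 1) \<theta> + t * f (k - 2) \<theta>
      - (of_int k + \<nu>) * f k \<theta>))"
  have cont: "continuous_on {-pi..pi} V"
  proof -
    have "continuous_on {-pi..pi} (\<lambda>\<theta>. exp (\<i> * of_real \<theta> * (\<mu> + 1 - \<nu>) / 2) *
      of_real (2 * cos (\<theta> / 2)) powr (\<mu> + 1 + \<nu>) * exp (t * cis \<theta>) * exp (- \<i> * of_int k * of_real \<theta>))"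
      using assms by (intro continuous_intros) (auto intro!: cos_ge_zero)
    then show ?thesis
      by (rule continuous_on_cong[THEN iffD1, rotated 2]) (auto simp: V_def circle_weight_altdef)
  qed
  have deriv: "(V has_vector_derivative V' \<theta>) (at \<theta>)" if "\<theta> \<in> {-pi<..<pi}" for \<theta>
  proof -
    have th: "\<bar>\<theta>\<bar> < pi" using that by auto
    note c = cos_half_pos[OF th]
    \<comment> \<open>\<open>E\<close> is a logarithm of \<open>V\<close> on the open interval, so
      the derivative of \<open>V\<close> is \<open>E'\<close> times \<open>V\<close>.\<close>
    define E where "E = (\<lambda>\<theta>. (\<i> * (\<mu> + 1 - \<nu>) / 2 - \<i> * of_int k) * of_real \<theta> +
      (\<mu> + 1 + \<nu>) * of_real (ln (2 * cos (\<theta> / 2))) + t * exp (\<i> * of_real \<theta>))"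
    define E' where "E' = (\<i> * (\<mu> + 1 - \<nu>) / 2 - \<i> * of_int k) +
      (\<mu> + 1 + \<nu>) * of_real (- (sin (\<theta> / 2) / (2 * cos (\<theta> / 2)))) + t * (\<i> * exp (\<i> * of_real \<theta>))"
    have VE: "V x = exp (E x)" if "\<bar>x\<bar> < pi" for x
      using that unfolding V_def E_def
      by (simp add: circle_weight_exp exp_add[symmetric] algebra_simps diff_divide_distrib add_divide_distrib)
    have ln': "((\<lambda>x. ln (2 * cos (x / 2))) has_vector_derivative (- (sin (\<theta> / 2) / (2 * cos (\<theta> / 2))))) (at \<theta>)"
      unfolding has_real_derivative_iff_has_vector_derivative[symmetric]
      using c by (auto intro!: derivative_eq_intros simp: field_simps)
    have expi: "((\<lambda>x. exp (\<i> * of_real x)) has_vector_derivative (\<i> * exp (\<i> * of_real \<theta>))) (at \<theta>)"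
    proof -
      have "((\<lambda>x. \<i> * of_real x) has_vector_derivative \<i>) (at \<theta>)"
        by (auto intro!: derivative_eq_intros)
      from field_vector_diff_chain_at[OF this DERIV_exp] show ?thesis by (simp add: o_def)
    qed
    have "(E has_vector_derivative E') (at \<theta>)"
      unfolding E_def E'_def
      by (intro has_vector_derivative_add has_vector_derivative_mult_right expi
          has_vector_derivative_of_real ln')
        (use c in \<open>auto intro!: derivative_eq_intros\<close>)
    from field_vector_diff_chain_at[OF this DERIV_exp]
    have "((\<lambda>x. exp (E x)) has_vector_derivative E' * exp (E \<theta>)) (at \<theta>)" by (simp add: o_def)
    then have "(V has_vector_derivative E' * exp (E \<theta>)) (at \<theta>)"
      by (rule has_vector_derivative_transform_within_open[where S = "{-pi<..<pi}"])
        (use that VE in auto)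
    moreover have "E' * exp (E \<theta>) = V' \<theta>"
    proof -
      let ?z = "cis \<theta>"
      have f1: "f (k - 1) \<theta> = ?z * f k \<theta>" and f2: "f (k - 2) \<theta> = ?z * ?z * f k \<theta>"
      proof -
        have "exp (- \<i> * of_int (k - j) * of_real \<theta>) = cis (of_int j * \<theta>) * exp (- \<i> * of_int k * of_real \<theta>)" for j
          unfolding cis_conv_exp exp_add[symmetric] by (rule arg_cong[where f = exp]) (simp add: algebra_simps)
        from this[of 1] this[of 2] show "f (k - 1) \<theta> = ?z * f k \<theta>" "f (k - 2) \<theta> = ?z * ?z * f k \<theta>"
          by (simp_all add: f_def cis_mult)
      qed
      \<comment> \<open>The logarithmic derivative of the cosine has a pole at the endpoints; the
        factor 1 + z cancels it and leaves a polynomial in z.\<close>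
      have tan: "of_real (- (sin (\<theta> / 2) / (2 * cos (\<theta> / 2)))) * (1 + ?z) = \<i> * (?z - 1) / 2"
      proof -
        have "?z - 1 = 2 * \<i> * of_real (sin (\<theta> / 2)) * exp (\<i> * of_real \<theta> / 2)"
        proof -
          have "?z - 1 = cis (\<theta> / 2) * (cis (\<theta> / 2) - cis (- \<theta> / 2))"
            by (simp add: right_diff_distrib cis_mult)
          also have "cis (\<theta> / 2) - cis (- \<theta> / 2) = 2 * \<i> * of_real (sin (\<theta> / 2))"
            by (simp add: complex_eq_iff)
          finally show ?thesis by (simp add: cis_conv_exp ac_simps)
        qed
        then show ?thesis using c unfolding one_plus_cis by simp
      qed
      have "E' * exp (E \<theta>) = E' * (1 + ?z) * f k \<theta>"
        using VE[OF th, symmetric] th by (simp add: V_def f_def circle_weight_Suc)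
      also have "E' * (1 + ?z) = (\<i> * (\<mu> + 1 - \<nu>) / 2 - \<i> * of_int k) * (1 + ?z) +
          (\<mu> + 1 + \<nu>) * (of_real (- (sin (\<theta> / 2) / (2 * cos (\<theta> / 2)))) * (1 + ?z)) + t * \<i> * ?z * (1 + ?z)"
        by (simp add: E'_def cis_conv_exp algebra_simps)
      also have "\<dots> = \<i> * ((\<mu> - of_int k + 1 + t) * ?z + t * (?z * ?z) - (of_int k + \<nu>))"
        unfolding tan by (simp add: field_simps)
      finally show ?thesis by (simp add: V'_def f1 f2 algebra_simps)
    qed
    ultimately show ?thesis by simp
  qed
  have "(V' has_integral V pi - V (- pi)) {-pi..pi}"
    by (rule fundamental_theorem_of_calculus_interior) (use cont deriv in auto)
  moreover have "V pi = 0" "V (- pi) = 0"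
    by (simp_all add: V_def circle_weight_altdef)
  ultimately have "integral {-pi..pi} V' = 0" by (simp add: integral_unique)
  moreover have fi: "f j integrable_on {-pi..pi}" for j
    unfolding f_def by (rule integrable_circle_weight) fact
  have "integral {-pi..pi} V' = \<i> * ((\<mu> - of_int k + 1 + t) * integral {-pi..pi} (f (k - 1)) +
     t * integral {-pi..pi} (f (k - 2)) - (of_int k + \<nu>) * integral {-pi..pi} (f k))"
    unfolding V'_def
    by (simp add: integral_diff integral_add fi integrable_on_mult_right integrable_add)
  ultimately have "(\<mu> - of_int k + 1 + t) * integral {-pi..pi} (f (k - 1)) +
     t * integral {-pi..pi} (f (k - 2)) - (of_int k + \<nu>) * integral {-pi..pi} (f k) = 0"
    by simp
  then have J: "(of_int k + \<nu>) * integral {-pi..pi} (f k) =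
      (\<mu> - of_int k + 1 + t) * integral {-pi..pi} (f (k - 1)) + t * integral {-pi..pi} (f (k - 2))"
    by simp
  have w: "w j = 1 / (2 * of_real pi) * integral {-pi..pi} (f j)" for j
    by (simp add: w_def fourier_coeff_def f_def)
  show ?thesis
    using arg_cong[OF J, of "\<lambda>x. 1 / (2 * of_real pi) * x"]
    unfolding w by (simp only: distrib_left mult.left_commute)
qed

section \<open>Initial values\<close>

lemma toeplitz_det_eq_toeplitz: "toeplitz_det \<epsilon> N w = toeplitz (fourier_coeff w) \<epsilon> N"
  by (simp add: toeplitz_det_def toeplitz_def)

lemma toeplitz_det_1: "toeplitz_det \<epsilon> 1 w = fourier_coeff w (- \<epsilon>)"
  by (simp add: toeplitz_det_def det_single)

lemma refl_coeff_1: "refl_coeff w 1 = - fourier_coeff w (- 1) / fourier_coeff w 0"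
  and refl_coeff_bar_1: "refl_coeff_bar w 1 = - fourier_coeff w 1 / fourier_coeff w 0"
  by (simp_all add: refl_coeff_def refl_coeff_bar_def toeplitz_det_1 del: One_nat_def)

text \<open>At t = 0 the recurrence has only two terms and is solved by a quotient of Pochhammer
  symbols; substitution into the expansion in powers of t gives the series. The pole condition keeps
  every denominator nonzero.\<close>

lemma fourier_coeff_circle_weight_eq_1F1:
  assumes re: "Re (\<mu> + \<nu>) > -1" and pole: "\<mu> - of_int k + 1 \<notin> \<int>\<^sub>\<le>\<^sub>0"
  shows "fourier_coeff (circle_weight \<mu> \<nu> t) k =
    fourier_coeff (circle_weight \<mu> \<nu> 0) k * hyp_1F1 (- \<nu> - of_int k) (\<mu> - of_int k + 1) (- t)"
proof -
  define c where "c = fourier_coeff (circle_weight \<mu> \<nu> 0)"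
  define a b where "a = - \<nu> - of_int k" and "b = \<mu> - of_int k + 1"
  have b: "b + of_nat n \<noteq> 0" for n
    using pole unfolding b_def by (metis add_eq_0_iff2 minus_of_nat_in_nonpos_Ints)
  have c_shift: "c (k - int n) = c k * ((- 1) ^ n * pochhammer a n / pochhammer b n)" for n
  proof (induction n)
    case (Suc n)
    have "(of_int (k - int n) + \<nu>) * c (k - int n) = (\<mu> - of_int (k - int n) + 1) * c (k - int n - 1)"
      using fourier_coeff_circle_weight_pearson[OF re, of "k - int n" 0] by (simp add: c_def)
    then have "(b + of_nat n) * c (k - int (Suc n)) = - (a + of_nat n) * c (k - int n)"
      by (simp add: a_def b_def algebra_simps)
    then have "c (k - int (Suc n)) = - ((a + of_nat n) / (b + of_nat n) * c (k - int n))"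
      using b[of n] by (simp add: field_simps)
    then show ?case
      by (simp add: Suc.IH pochhammer_Suc ac_simps)
  qed simp
  have "(\<lambda>n. t ^ n / fact n * c (k - int n)) sums fourier_coeff (circle_weight \<mu> \<nu> t) k"
    unfolding c_def by (rule fourier_coeff_circle_weight_sums) fact
  also have "(\<lambda>n. t ^ n / fact n * c (k - int n)) =
      (\<lambda>n. c k * (pochhammer a n / pochhammer b n * (- t) ^ n / fact n))"
    by (simp add: c_shift power_minus[of t] ac_simps)
  finally have sums: "(\<lambda>n. c k * (pochhammer a n / pochhammer b n * (- t) ^ n / fact n)) sums
    fourier_coeff (circle_weight \<mu> \<nu> t) k" .
  show ?thesis
  \<comment> \<open>Convergence of the hypergeometric series is obtained by dividing by
    \<open>c k\<close>; if that is 0, both sides vanish.\<close>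
  proof (cases "c k = 0")
    case True
    then show ?thesis using sums_unique[OF sums] by (simp add: c_def)
  next
    case False
    then have "(\<lambda>n. pochhammer a n / pochhammer b n * (- t) ^ n / fact n) sums
        (fourier_coeff (circle_weight \<mu> \<nu> t) k / c k)"
      using sums_divide[OF sums, of "c k"] by simp
    then show ?thesis
      using False by (simp add: hyp_1F1_eq_suminf sums_iff c_def a_def b_def)
  qed
qed

lemma refl_coeff_1_eq_1F1:
  assumes re: "Re (\<mu> + \<nu>) > -1" and pole: "\<mu> \<notin> \<int>\<^sub>\<le>\<^sub>0"
    and nz: "fourier_coeff (circle_weight \<mu> \<nu> t) 0 \<noteq> 0"
  shows "refl_coeff (circle_weight \<mu> \<nu> t) 1 = - (\<nu> / (\<mu> + 1)) *
      (hyp_1F1 (- \<nu> + 1) (\<mu> + 2) (- t) / hyp_1F1 (- \<nu>) (\<mu> + 1) (- t))"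
    and "refl_coeff_bar (circle_weight \<mu> \<nu> t) 1 = - (\<mu> / (\<nu> + 1)) *
      (hyp_1F1 (- \<nu> - 1) \<mu> (- t) / hyp_1F1 (- \<nu>) (\<mu> + 1) (- t))"
proof -
  define c where "c = fourier_coeff (circle_weight \<mu> \<nu> 0)"
  \<comment> \<open>This makes the lower parameters \<mu> + 1 and \<mu> + 2 admissible as well as
    \<mu>.\<close>
  have pole': "\<mu> + of_nat n \<notin> \<int>\<^sub>\<le>\<^sub>0" for n
    using pole nonpos_Ints_diff_Nats[of "\<mu> + of_nat n" "of_nat n"] by auto
  have \<mu>: "\<mu> \<noteq> 0" "\<mu> + 1 \<noteq> 0" using pole pole'[of 1] by auto
  have w0: "fourier_coeff (circle_weight \<mu> \<nu> t) 0 = c 0 * hyp_1F1 (- \<nu>) (\<mu> + 1) (- t)"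
    using fourier_coeff_circle_weight_eq_1F1[OF re, of 0 t] pole'[of 1] by (simp add: c_def)
  have w_minus: "fourier_coeff (circle_weight \<mu> \<nu> t) (- 1) = c (- 1) * hyp_1F1 (- \<nu> + 1) (\<mu> + 2) (- t)"
    using fourier_coeff_circle_weight_eq_1F1[OF re, of "-1" t] pole'[of 2] by (simp add: c_def add.commute)
  have w1: "fourier_coeff (circle_weight \<mu> \<nu> t) 1 = c 1 * hyp_1F1 (- \<nu> - 1) \<mu> (- t)"
    using fourier_coeff_circle_weight_eq_1F1[OF re, of 1 t] pole by (simp add: c_def)
  have c0: "c 0 \<noteq> 0" using nz w0 by auto
  have 1: "\<nu> * c 0 = (\<mu> + 1) * c (- 1)" and 2: "(\<nu> + 1) * c 1 = \<mu> * c 0"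
    using fourier_coeff_circle_weight_pearson[OF re, of 0 0]
      fourier_coeff_circle_weight_pearson[OF re, of 1 0] by (simp_all add: c_def add.commute)
  \<comment> \<open>Otherwise the second relation would make \<mu> times \<open>c 0\<close> vanish,
    although both factors are nonzero.\<close>
  have \<nu>: "\<nu> + 1 \<noteq> 0" using 2 c0 \<mu> by auto
  have "c (- 1) = \<nu> / (\<mu> + 1) * c 0" "c 1 = \<mu> / (\<nu> + 1) * c 0"
    using 1 2 \<mu> \<nu> by (simp_all add: field_simps)
  then show "refl_coeff (circle_weight \<mu> \<nu> t) 1 = - (\<nu> / (\<mu> + 1)) *
      (hyp_1F1 (- \<nu> + 1) (\<mu> + 2) (- t) / hyp_1F1 (- \<nu>) (\<mu> + 1) (- t))"
    "refl_coeff_bar (circle_weight \<mu> \<nu> t) 1 = - (\<mu> / (\<nu> + 1)) *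
      (hyp_1F1 (- \<nu> - 1) \<mu> (- t) / hyp_1F1 (- \<nu>) (\<mu> + 1) (- t))"
    using c0 unfolding refl_coeff_1 refl_coeff_bar_1 w0 w_minus w1 by simp_all
qed

lemma eventually_at_not_nonpos_Int: "eventually (\<lambda>m. m \<notin> \<int>\<^sub>\<le>\<^sub>0) (at \<mu>)" if "\<mu> \<in> \<int>\<^sub>\<le>\<^sub>0"
  for \<mu> :: complex
  unfolding eventually_at
proof (intro exI[of _ 1] conjI ballI impI notI)
  fix m :: complex assume m: "m \<noteq> \<mu> \<and> dist m \<mu> < 1" "m \<in> \<int>\<^sub>\<le>\<^sub>0"
  with that obtain i j where "m = of_int i" "\<mu> = of_int j"
    by (metis nonpos_Ints_cases)
  with m(1) have "i \<noteq> j" "cmod (of_int (i - j)) < 1" by (auto simp: dist_norm)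
  then show False by (simp only: norm_of_int)
qed auto

section \<open>Transfer to the weight, with the limit at the exceptional values of \<mu>\<close>

theorem proposition4p1:
  fixes \<mu> \<nu> t :: complex
    and w :: "real \<Rightarrow> complex"
    and r rb :: "nat \<Rightarrow> complex"
    and r1 rb1 :: "complex \<Rightarrow> complex"
  defines "w \<equiv> circle_weight \<mu> \<nu> t"
    and "r \<equiv> refl_coeff w"
    and "rb \<equiv> refl_coeff_bar w"
    and "r1 \<equiv> \<lambda>m. - (\<nu> / (m + 1)) *
           (hyp_1F1 (- \<nu> + 1) (m + 2) (- t) / hyp_1F1 (- \<nu>) (m + 1) (- t))"
    and "rb1 \<equiv> \<lambda>m. - (m / (\<nu> + 1)) *
           (hyp_1F1 (- \<nu> - 1) m (- t) / hyp_1F1 (- \<nu>) (m + 1) (- t))"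
  assumes "Re (\<mu> + \<nu>) > -1"
    and "\<forall>N\<ge>1. toeplitz_det 0 N w \<noteq> 0"
  shows "(\<forall>N\<ge>1.
            (of_nat N - 1 + \<nu>) * r (N - 1) + (of_nat N + \<mu> + t) * r N =
              - t * (1 - r N * rb N) * r (N + 1) + t * (r N)\<^sup>2 * rb (N - 1) \<and>
            (of_nat N + 1 + \<nu>) * rb (N + 1) + (of_nat N + \<mu> + t) * rb N =
              - t * (1 - r N * rb N) * rb (N - 1) + t * (rb N)\<^sup>2 * r (N + 1)) \<and>
         r 0 = 1 \<and> rb 0 = 1 \<and>
         (\<mu> \<notin> \<int>\<^sub>\<le>\<^sub>0 \<longrightarrow> r 1 = r1 \<mu> \<and> rb 1 = rb1 \<mu>) \<and>
         (\<mu> \<in> \<int>\<^sub>\<le>\<^sub>0 \<longrightarrow> (r1 \<longlongrightarrow> r 1) (at \<mu>) \<and> (rb1 \<longlongrightarrow> rb 1) (at \<mu>))"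
proof -
  note re = \<open>Re (\<mu> + \<nu>) > -1\<close>
  interpret sys: pearson_toeplitz_system "fourier_coeff w" \<mu> \<nu> t
  proof
    \<comment> \<open>The hypothesis starts at N = 1; the empty determinant for N = 0 is 1.\<close>
    show "toeplitz (fourier_coeff w) 0 N \<noteq> 0" for N
      using assms(7) toeplitz_det_0[of 0 w]
      unfolding toeplitz_det_eq_toeplitz by (cases "N = 0") auto
    show "(of_int k + \<nu>) * fourier_coeff w k =
        (\<mu> - of_int k + 1 + t) * fourier_coeff w (k - 1) + t * fourier_coeff w (k - 2)" for k
      unfolding w_def by (rule fourier_coeff_circle_weight_pearson) fact
  qed
  have r_eq: "r = sys.r" and rb_eq: "rb = sys.rb"
    by (simp_all add: fun_eq_iff assms(2,3) refl_coeff_def refl_coeff_bar_def toeplitz_det_eq_toeplitz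
        sys.r_eq_toeplitz sys.rb_eq_toeplitz)
  have rec: "(of_nat N - 1 + \<nu>) * r (N - 1) + (of_nat N + \<mu> + t) * r N =
        - t * (1 - r N * rb N) * r (N + 1) + t * (r N)\<^sup>2 * rb (N - 1) \<and>
      (of_nat N + 1 + \<nu>) * rb (N + 1) + (of_nat N + \<mu> + t) * rb N =
        - t * (1 - r N * rb N) * rb (N - 1) + t * (rb N)\<^sup>2 * r (N + 1)" if "N \<ge> 1" for N
  proof -
    from that obtain n where N: "N = Suc n" by (cases N) auto
    show ?thesis
      using sys.r_recurrence[of n] sys.rb_recurrence[of n] by (simp add: N r_eq rb_eq)
  qed
  define W where "W = (\<lambda>m k. fourier_coeff (circle_weight m \<nu> t) k)"
  \<comment> \<open>The zeroth Fourier coefficient is the Toeplitz determinant of size 1.\<close>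
  have W0: "W \<mu> 0 \<noteq> 0"
    using assms(7) toeplitz_det_1[of 0 w] by (auto simp: W_def w_def simp del: One_nat_def)
  have r_1: "refl_coeff (circle_weight m \<nu> t) 1 = r1 m \<and> refl_coeff_bar (circle_weight m \<nu> t) 1 = rb1 m"
    if "Re (m + \<nu>) > -1" "m \<notin> \<int>\<^sub>\<le>\<^sub>0" "W m 0 \<noteq> 0" for m
    using refl_coeff_1_eq_1F1[OF that(1,2)] that(3) by (simp add: W_def r1_def rb1_def)
  have cont: "((\<lambda>m. W m k) \<longlongrightarrow> W \<mu> k) (at \<mu>)" for k
    using isCont_fourier_coeff_circle_weight[OF re] by (simp add: W_def isCont_def)
  have limit: "(r1 \<longlongrightarrow> r 1) (at \<mu>)" "(rb1 \<longlongrightarrow> rb 1) (at \<mu>)" if "\<mu> \<in> \<int>\<^sub>\<le>\<^sub>0"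
  proof -
    have "eventually (\<lambda>m. Re (m + \<nu>) > -1) (at \<mu>)"
      by (intro order_tendstoD(1)[OF _ re] tendsto_Re tendsto_add tendsto_const tendsto_ident_at)
    moreover have "eventually (\<lambda>m. W m 0 \<noteq> 0) (at \<mu>)"
      by (rule tendsto_imp_eventually_ne[OF cont W0])
    \<comment> \<open>In a punctured neighbourhood of \<mu> the generic formulas hold, so
      \<open>r1\<close> and \<open>rb1\<close> equal quotients of Fourier coefficients there, and
      these are continuous at \<mu> itself.\<close>
    ultimately have ev: "eventually (\<lambda>m. r1 m = - W m (- 1) / W m 0 \<and> rb1 m = - W m 1 / W m 0) (at \<mu>)"
      using eventually_at_not_nonpos_Int[OF that]
      by eventually_elim (use r_1 in \<open>simp add: refl_coeff_1 refl_coeff_bar_1 W_def del: One_nat_def\<close>)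
    have lim: "((\<lambda>m. - W m k / W m 0) \<longlongrightarrow> - W \<mu> k / W \<mu> 0) (at \<mu>)" for k
      by (intro tendsto_intros cont W0)
    have "r 1 = - W \<mu> (- 1) / W \<mu> 0" "rb 1 = - W \<mu> 1 / W \<mu> 0"
      by (simp_all only: r_def rb_def refl_coeff_1 refl_coeff_bar_1 W_def w_def)
    moreover have "(r1 \<longlongrightarrow> - W \<mu> (- 1) / W \<mu> 0) (at \<mu>)"
      by (rule Lim_transform_eventually[OF lim]) (use ev in eventually_elim, simp)
    moreover have "(rb1 \<longlongrightarrow> - W \<mu> 1 / W \<mu> 0) (at \<mu>)"
      by (rule Lim_transform_eventually[OF lim]) (use ev in eventually_elim, simp)
    ultimately show "(r1 \<longlongrightarrow> r 1) (at \<mu>)" "(rb1 \<longlongrightarrow> rb 1) (at \<mu>)"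
      by (simp_all only:)
  qed
  show ?thesis
    using rec limit r_1[OF re _ W0] by (simp add: r_eq rb_eq r_def[symmetric] rb_def[symmetric] w_def[symmetric])
qed

end
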